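(* Let $-\infty<a<b<\infty$, $A,B\in\mathbb R$, and let $F:[a,b]\times\mathbb R^2\to\mathbb R$, $(x,y,z)\mapsto F(x,y,z)$, be a continuous function such that: (i) $(x,y)\mapsto F(x,y,0)$ has linear growth with respect to $y$, uniformly in $x\in[a,b]$; (ii) $(F(x,y,z)-F(x,\tilde y,z))(y-\tilde y)\ge 0$ for all $y,\tilde y,z\in\mathbb R$, $x\in[a,b]$; (iii) $F$ is globally Lipschitz with respect to $z$, i.e. there is a constant $k$ with $|F(x,y,z)-F(x,y,\tilde z)|\le k|z-\tilde z|$ for all $x\in[a,b]$, $y,z,\tilde z\in\mathbb R$. Then there exists exactly one solution of the boundary value problem $$Lu(x)=F(x,u,u'),\qquad u(a)=A,\qquad u(b)=B .$$
   Context: Let $\sigma,\beta:\mathbb R\to\mathbb R$ be continuous with $\sigma>0$. $C^0$ denotes the continuous functions on $\mathbb R$ with the topology of uniform convergence on compacts; $C^k$ the $k$-times continuously differentiable functions on $\mathbb R$ with the topology of uniform convergence on compacts of the function and its first $k$ derivatives. Formally $Lg=\frac{\sigma^2}{2}g''+\beta'g'$. A mollifier is a Schwartz function $\Phi$ on $\mathbb R$ with $\int\Phi(x)\,dx=1$; put $\Phi_n(x)=n\Phi(nx)$, $\sigma_n^2=\sigma^2*\Phi_n$, $\beta_n=\beta*\Phi_n$ (these convolutions are understood to be well defined, as absolutely convergent integrals, for every mollifier) and $L_ng=\frac{\sigma_n^2}{2}g''+\beta_n'g'$. Standing assumption: $\Sigma(x)=\lim_{n\to\infty}2\int_0^x\frac{\beta_n'}{\sigma_n^2}(y)\,dy$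 exists in $C^0$, independently of the mollifier. For $l\in C^0$, a function $f\in C^1$ is a $C^1$-solution of $Lf=l$ if for every mollifier $\Phi$ there are sequences $(f_n)$ in $C^2$ and $(l_n)$ in $C^0$ with $L_nf_n=l_n$, $f_n\to f$ in $C^1$, $l_n\to l$ in $C^0$. Boundary value problems: let $-\infty<a<b<\infty$, $A,B\in\mathbb R$. For continuous $g:[a,b]\to\mathbb R$, a function $u:[a,b]\to\mathbb R$ is a solution of $Lu=g$, $u(a)=A$, $u(b)=B$ if there are a continuous extension $\tilde g:\mathbb R\to\mathbb R$ of $g$ and $\tilde u\in C^1$ with $\tilde u|_{[a,b]}=u$ such that $\tilde u$ is a $C^1$-solution of $L\tilde u=\tilde g$ and $\tilde u(a)=A$, $\tilde u(b)=B$. For continuous $F:[a,b]\times\mathbb R^2\to\mathbb R$, a function $u\in C^1([a,b])$ is a solution of $Lu=F(x,u,u')$, $u(a)=A$, $u(b)=B$ if it is a solution, in the previous sense, of $Lu=\ell$, $u(a)=A$, $u(b)=B$ with $\ell(x)=F(x,u(x),u'(x))$. *)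

theory Defs
  imports "HOL-Analysis.Analysis"
begin

text \<open>The function spaces \<open>C\<^sup>k\<close>; \<open>Ck 0\<close> consists of the continuous functions.\<close>

definition Ck :: "nat \<Rightarrow> (real \<Rightarrow> real) set" where
  "Ck k = {f. (\<forall>i<k. \<forall>x. (deriv ^^ i) f differentiable (at x)) \<and>
             continuous_on UNIV ((deriv ^^ k) f)}"

text \<open>Convergence concerns only the tail of the sequence on each compact set, so it also makes
  sense when the members of the sequence are well behaved on a given compact set only for large
  indices.\<close>

definition converges_Ck :: "nat \<Rightarrow> (nat \<Rightarrow> real \<Rightarrow> real) \<Rightarrow> (real \<Rightarrow> real) \<Rightarrow> bool" where
  "converges_Ck k f g \<longleftrightarrow>
     (\<forall>i\<le>k. \<forall>K. compact K \<longrightarrow>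
        uniform_limit K (\<lambda>n. (deriv ^^ i) (f n)) ((deriv ^^ i) g) sequentially)"

definition schwartz :: "(real \<Rightarrow> real) \<Rightarrow> bool" where
  "schwartz \<Phi> \<longleftrightarrow> (\<forall>k. \<Phi> \<in> Ck k) \<and>
     (\<forall>j k. bounded (range (\<lambda>x. x ^ j * (deriv ^^ k) \<Phi> x)))"

definition mollifier :: "(real \<Rightarrow> real) \<Rightarrow> bool" where
  "mollifier \<Phi> \<longleftrightarrow> schwartz \<Phi> \<and> (LINT x|lborel. \<Phi> x) = 1"

definition dilate :: "(real \<Rightarrow> real) \<Rightarrow> nat \<Rightarrow> real \<Rightarrow> real" where
  "dilate \<Phi> n x = real n * \<Phi> (real n * x)"

definition convolvable :: "(real \<Rightarrow> real) \<Rightarrow> (real \<Rightarrow> real) \<Rightarrow> bool" where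
  "convolvable f g \<longleftrightarrow> (\<forall>x. integrable lborel (\<lambda>y. f (x - y) * g y))"

definition convol :: "(real \<Rightarrow> real) \<Rightarrow> (real \<Rightarrow> real) \<Rightarrow> real \<Rightarrow> real" where
  "convol f g x = (LINT y|lborel. f (x - y) * g y)"

definition sigma2_n :: "(real \<Rightarrow> real) \<Rightarrow> (real \<Rightarrow> real) \<Rightarrow> nat \<Rightarrow> real \<Rightarrow> real" where
  "sigma2_n \<sigma> \<Phi> n = convol (\<lambda>x. (\<sigma> x)\<^sup>2) (dilate \<Phi> n)"

definition beta_n :: "(real \<Rightarrow> real) \<Rightarrow> (real \<Rightarrow> real) \<Rightarrow> nat \<Rightarrow> real \<Rightarrow> real" where
  "beta_n \<beta> \<Phi> n = convol \<beta> (dilate \<Phi> n)"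

definition L_n ::
    "(real \<Rightarrow> real) \<Rightarrow> (real \<Rightarrow> real) \<Rightarrow> (real \<Rightarrow> real) \<Rightarrow> nat \<Rightarrow> (real \<Rightarrow> real) \<Rightarrow> real \<Rightarrow> real" where
  "L_n \<sigma> \<beta> \<Phi> n g x =
     sigma2_n \<sigma> \<Phi> n x / 2 * deriv (deriv g) x + deriv (beta_n \<beta> \<Phi> n) x * deriv g x"

definition convolutions_defined :: "(real \<Rightarrow> real) \<Rightarrow> (real \<Rightarrow> real) \<Rightarrow> bool" where
  "convolutions_defined \<sigma> \<beta> \<longleftrightarrow>
     (\<forall>\<Phi>. mollifier \<Phi> \<longrightarrow> (\<forall>n\<ge>1.
        convolvable (\<lambda>x. (\<sigma> x)\<^sup>2) (dilate \<Phi> n) \<and> convolvable \<beta> (dilate \<Phi> n)))"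

text \<open>The interval integral is signed, also for \<open>x < 0\<close>. Since \<open>\<Phi>\<close> may change sign,
  \<open>sigma2_n\<close> is guaranteed to be positive on a given compact set only for large \<open>n\<close>.\<close>

definition is_Sigma :: "(real \<Rightarrow> real) \<Rightarrow> (real \<Rightarrow> real) \<Rightarrow> (real \<Rightarrow> real) \<Rightarrow> bool" where
  "is_Sigma \<sigma> \<beta> \<Sigma> \<longleftrightarrow> \<Sigma> \<in> Ck 0 \<and>
     (\<forall>\<Phi>. mollifier \<Phi> \<longrightarrow>
        converges_Ck 0
          (\<lambda>n x. 2 * (LBINT y=ereal 0..ereal x. deriv (beta_n \<beta> \<Phi> n) y / sigma2_n \<sigma> \<Phi> n y)) \<Sigma>)"

definition C1_solution ::
    "(real \<Rightarrow> real) \<Rightarrow> (real \<Rightarrow> real) \<Rightarrow> (real \<Rightarrow> real) \<Rightarrow> (real \<Rightarrow> real) \<Rightarrow> bool" where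
  "C1_solution \<sigma> \<beta> l f \<longleftrightarrow> l \<in> Ck 0 \<and> f \<in> Ck 1 \<and>
     (\<forall>\<Phi>. mollifier \<Phi> \<longrightarrow>
        (\<exists>fs ls. (\<forall>n\<ge>1. fs n \<in> Ck 2 \<and> ls n \<in> Ck 0 \<and> L_n \<sigma> \<beta> \<Phi> n (fs n) = ls n) \<and>
                 converges_Ck 1 fs f \<and> converges_Ck 0 ls l))"

text \<open>In the boundary value problems, functions on \<open>[a,b]\<close> are total functions of which only the
  values on \<open>{a..b}\<close> matter.\<close>

definition bvp_solution ::
    "(real \<Rightarrow> real) \<Rightarrow> (real \<Rightarrow> real) \<Rightarrow> real \<Rightarrow> real \<Rightarrow> real \<Rightarrow> real \<Rightarrow>
     (real \<Rightarrow> real) \<Rightarrow> (real \<Rightarrow> real) \<Rightarrow> bool" where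
  "bvp_solution \<sigma> \<beta> a b A B g u \<longleftrightarrow>
     (\<exists>gt ut. gt \<in> Ck 0 \<and> (\<forall>x\<in>{a..b}. gt x = g x) \<and>
              ut \<in> Ck 1 \<and> (\<forall>x\<in>{a..b}. ut x = u x) \<and>
              C1_solution \<sigma> \<beta> gt ut \<and> ut a = A \<and> ut b = B)"

text \<open>The derivative \<open>u'\<close> of \<open>u \<in> C\<^sup>1([a,b])\<close> is one-sided at the endpoints; it is uniquely
  determined on \<open>[a,b]\<close> when \<open>a < b\<close>.\<close>

definition bvp_solution_nonlinear ::
    "(real \<Rightarrow> real) \<Rightarrow> (real \<Rightarrow> real) \<Rightarrow> real \<Rightarrow> real \<Rightarrow> real \<Rightarrow> real \<Rightarrow>
     (real \<times> real \<times> real \<Rightarrow> real) \<Rightarrow> (real \<Rightarrow> real) \<Rightarrow> bool" where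
  "bvp_solution_nonlinear \<sigma> \<beta> a b A B F u \<longleftrightarrow>
     (\<exists>u'. (\<forall>x\<in>{a..b}. (u has_real_derivative u' x) (at x within {a..b})) \<and>
           continuous_on {a..b} u' \<and>
           bvp_solution \<sigma> \<beta> a b A B (\<lambda>x. F (x, u x, u' x)) u)"

end

theory Submission
  imports Defs "HOL-Complex_Analysis.Great_Picard"
begin

text \<open>With \<open>P = exp \<Sigma> * u'\<close>, a \<open>C\<^sup>1\<close>-solution of \<open>L u = l\<close> is the same as a solution of the regular
  system \<open>u' = exp (- \<Sigma>) * P\<close>, \<open>P' = 2 * exp \<Sigma> * l / \<sigma>\<^sup>2\<close>: multiplying \<open>L\<^sub>n f\<^sub>n = l\<^sub>n\<close> by the integrating
  factor gives the regularized version of this system, whose coefficients converge locally uniformly.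
  That the convolutions exist for all mollifiers forces \<open>\<sigma>\<^sup>2\<close> and \<open>\<beta>\<close> to have polynomial growth in the
  mean; otherwise a series of ever wider, rapidly weighted Gaussians would be a mollifier against which
  the function is not integrable. Hence they may be convolved with arbitrary Schwartz functions.

  Uniqueness of the boundary value problem is a maximum principle: to the right of a positive maximum
  of the difference of two solutions, monotonicity in \<open>y\<close>, the Lipschitz condition in \<open>z\<close> and Gronwall's
  inequality prevent it from decreasing. The same comparison yields a priori bounds, which
  reduce existence to bounded right-hand sides. There a delayed equation is solved by shooting (a
  bounded right-hand side makes the endpoint tend to infinity with the initial slope), and
  Arzela-Ascoli allows the delay to tend to \<open>0\<close>.\<close>

subsection \<open>Two-point problems with bounded right-hand side\<close>

text \<open>\<open>F\<close> is merely continuous in \<open>y\<close>, so the initial value problem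
  behind a shooting argument may have several solutions: for
  \<open>u'' = 12 * sqrt (max u 0)\<close> both \<open>0\<close> and \<open>x ^ 4\<close> start from
  rest at \<open>0\<close>. The endpoint is then no function of the slope, and a contraction
  argument has no Lipschitz constant in \<open>y\<close>. A positive delay makes the endpoint a
  continuous function of the slope; the price is a compactness argument when the delay is removed.
  Since \<open>exp (- \<Sigma>)\<close> is only continuous, \<open>u'\<close> need not be
  differentiable. The maximum principle therefore argues with \<open>P\<close> instead of a second
  derivative: \<open>P\<close> vanishes at an interior maximum, and its growth to the right of it is
  controlled. Uniqueness and the a priori bound are one estimate with an error term
  \<open>\<rho>\<close>: \<open>\<rho> = 0\<close> compares two solutions, while
  \<open>\<rho>\<close> a bound for the right-hand side at \<open>(x, 0, 0)\<close> compares a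
  solution with zero. These bounds see the right-hand side only through the Lipschitz constant and
  its values at vanishing \<open>P\<close>, and so are unaffected by a truncation in
  \<open>P\<close>.\<close>

lemma antiderivative_ex:
  fixes g :: "real \<Rightarrow> real"
  assumes "continuous_on UNIV g"
  obtains G where "G c = v" "\<And>x. (G has_real_derivative g x) (at x)"
proof -
  obtain F where F: "\<And>x. (F has_vector_derivative g x) (at x)"
    using einterval_antiderivative[of "-\<infinity>" "\<infinity>" g] assms
    by (auto simp: continuous_on_eq_continuous_at)
  define G where "G = (\<lambda>x. F x + (v - F c))"
  have "(G has_real_derivative g x) (at x)" for x
    unfolding G_def
    using F[of x] by (auto intro!: derivative_eq_intros simp: has_real_derivative_iff_has_vector_derivative)
  then show ?thesis
    using that[of G] by (simp add: G_def)
qed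

lemma integral_eq_antiderivative_diff:
  fixes G g :: "real \<Rightarrow> real"
  assumes "\<And>x. x \<in> {a..b} \<Longrightarrow> (G has_real_derivative g x) (at x within {a..b})" "a \<le> b"
  shows "integral {a..b} g = G b - G a"
  using fundamental_theorem_of_calculus[of a b G g] assms
  by (auto simp: has_real_derivative_iff_has_vector_derivative intro: integral_unique)

text \<open>For \<open>x < a\<close> both the factor \<open>max a x - a\<close> and the integral
  over the empty interval vanish, so one formula covers all \<open>x\<close>. With the variable
  endpoint moved into the integrand, continuity in the endpoint becomes continuity of an integral
  over the fixed interval \<open>{0..1}\<close>.\<close>

lemma integral_rescale:
  fixes f :: "real \<Rightarrow> real"
  assumes "continuous_on UNIV f"
  shows "integral {a..x} f = (max a x - a) * integral {0..1} (\<lambda>s. f (a + s * (max a x - a)))"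
proof (cases "a \<le> x")
  case True
  obtain G where G: "\<And>x. (G has_real_derivative f x) (at x)"
    using antiderivative_ex[OF assms] by metis
  have "integral {a..x} f = G x - G a"
    by (rule integral_eq_antiderivative_diff) (use G True in \<open>auto intro: has_field_derivative_at_within\<close>)
  moreover have "integral {0..1} (\<lambda>s. (x - a) * f (a + s * (x - a))) = G (a + 1 * (x - a)) - G (a + 0 * (x - a))"
  proof (rule integral_eq_antiderivative_diff[where G = "\<lambda>s. G (a + s * (x - a))"])
    fix s :: real
    show "((\<lambda>s. G (a + s * (x - a))) has_real_derivative (x - a) * f (a + s * (x - a))) (at s within {0..1})"
      by (rule DERIV_chain2[where f = G and g = "\<lambda>s. a + s * (x - a)", THEN DERIV_cong, OF G])
        (auto intro!: derivative_eq_intros)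
  qed auto
  ultimately show ?thesis
    using True by (simp add: max_def)
qed (auto simp: max_def)

lemma continuous_on_section:
  assumes "continuous_on UNIV (\<lambda>(p, t). f p t)"
  shows "continuous_on UNIV (f p)"
proof -
  have "continuous_on UNIV (\<lambda>t. (p, t))"
    by (intro continuous_intros)
  from continuous_on_compose2[OF assms this] show ?thesis
    by simp
qed

lemma continuous_on_integral_upper:
  fixes f :: "real \<Rightarrow> real \<Rightarrow> real"
  assumes "continuous_on UNIV (\<lambda>(p, t). f p t)"
  shows "continuous_on UNIV (\<lambda>(p, x). integral {a..x} (f p))"
proof -
  have *: "continuous_on UNIV (f p)" for p
    by (rule continuous_on_section) fact
  have "continuous_on UNIV
     (\<lambda>z. integral (cbox 0 (1::real)) (\<lambda>s. f (fst z) (a + s * (max a (snd z) - a))))"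
  proof (rule integral_continuous_on_param)
    show "continuous_on (UNIV \<times> cbox 0 (1::real)) (\<lambda>(z, s). f (fst z) (a + s * (max a (snd z) - a)))"
      using continuous_on_compose2[OF assms, where s = "UNIV \<times> cbox 0 (1::real)" and 
          f = "\<lambda>z. (fst (fst z), a + snd z * (max a (snd (fst z)) - a))", OF _ subset_UNIV]
      by (simp add: case_prod_beta continuous_on_Pair continuous_on_fst continuous_on_snd
          continuous_on_max continuous_on_mult continuous_on_diff continuous_on_add)
  qed
  then have "continuous_on UNIV
     (\<lambda>z. (max a (snd z) - a) * integral {0..1} (\<lambda>s. f (fst z) (a + s * (max a (snd z) - a))))"
    by (auto intro!: continuous_intros)
  then show ?thesis
    by (simp add: integral_rescale[OF *] case_prod_beta)
qed

text \<open>With right-hand side evaluated at the earlier time \<open>t - \<tau>\<close>, Picard iteration started at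
  slope \<open>p\<close> becomes stationary on \<open>[a,b]\<close> after finitely many steps, so no fixed-point theorem is
  needed, and the solution depends continuously on \<open>p\<close>.\<close>

primrec delay_iter ::
    "real \<Rightarrow> (real \<Rightarrow> real) \<Rightarrow> (real \<Rightarrow> real \<Rightarrow> real \<Rightarrow> real) \<Rightarrow> real \<Rightarrow> nat \<Rightarrow> real \<Rightarrow> real \<Rightarrow> real" where
  "delay_iter a e h \<tau> 0 p x = p"
| "delay_iter a e h \<tau> (Suc j) p x = p + integral {a..x} (\<lambda>t.
     h t (integral {a..max a (t - \<tau>)} (\<lambda>s. e s * delay_iter a e h \<tau> j p s))
         (delay_iter a e h \<tau> j p (max a (t - \<tau>))))"

lemma continuous_delay_rhs:
  fixes e :: "real \<Rightarrow> real" and h :: "real \<Rightarrow> real \<Rightarrow> real \<Rightarrow> real" and P :: "real \<Rightarrow> real \<Rightarrow> real"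
  assumes e: "continuous_on UNIV e" and h: "continuous_on UNIV (\<lambda>(t, y, q). h t y q)"
    and P: "continuous_on UNIV (\<lambda>(p, x). P p x)"
  shows "continuous_on UNIV (\<lambda>(p, t). h t (integral {a..max a (t - \<tau>)} (\<lambda>s. e s * P p s))
         (P p (max a (t - \<tau>))))"
proof -
  have "continuous_on UNIV (\<lambda>z::real \<times> real. e (snd z))"
    by (rule continuous_on_compose2[OF e]) (auto intro!: continuous_intros)
  then have eP: "continuous_on UNIV (\<lambda>(p, s). e s * P p s)"
    using P by (auto intro!: continuous_intros simp: case_prod_beta)
  have shift: "continuous_on UNIV (\<lambda>z::real \<times> real. (fst z, max a (snd z - \<tau>)))"
    by (intro continuous_intros)
  have "continuous_on UNIV (\<lambda>z. (snd z, integral {a..max a (snd z - \<tau>)} (\<lambda>s. e s * P (fst z) s),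
        P (fst z) (max a (snd z - \<tau>))))"
    using continuous_on_compose2[OF continuous_on_integral_upper[OF eP, of a] shift]
      continuous_on_compose2[OF P shift]
    by (auto intro!: continuous_on_Pair continuous_on_snd continuous_on_id)
  from continuous_on_compose2[OF h this] show ?thesis
    by (simp add: case_prod_beta)
qed

lemma continuous_delay_iter:
  assumes "continuous_on UNIV e" "continuous_on UNIV (\<lambda>(t, y, q). h t y q)"
  shows "continuous_on UNIV (\<lambda>(p, x). delay_iter a e h \<tau> j p x)"
proof (induction j)
  case 0
  show ?case by (auto intro!: continuous_intros simp: case_prod_beta)
next
  case (Suc j)
  show ?case
    using continuous_on_integral_upper[OF continuous_delay_rhs[OF assms Suc]]
    by (auto intro!: continuous_intros simp: case_prod_beta)
qed

text \<open>At time \<open>t\<close> the right-hand side looks back only as far as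
  \<open>max a (t - \<tau>)\<close>, so each iteration settles a further stretch of length
  \<open>\<tau>\<close>.\<close>

lemma delay_iter_stationary:
  assumes "\<tau> > 0" "x \<le> a + real j * \<tau>"
  shows "delay_iter a e h \<tau> (Suc j) p x = delay_iter a e h \<tau> j p x"
  using assms(2)
proof (induction j arbitrary: x)
  case 0
  then have "x \<le> a" by simp
  then have "{a..x} = {} \<or> {a..x} = {a..a}" by auto
  then show ?case by (auto simp del: atLeastatMost_empty_iff2)
next
  case (Suc j)
  have "delay_iter a e h \<tau> (Suc j) p s = delay_iter a e h \<tau> j p s"
    if "t \<le> x" "s \<le> max a (t - \<tau>)" for s t
    using that Suc.prems assms(1) by (intro Suc.IH) (auto simp: algebra_simps max_def split: if_splits intro: order_trans add_increasing2)
  note * = this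
  show ?case
    unfolding delay_iter.simps(2)[of a e h \<tau> "Suc j"] 
    by (subst delay_iter.simps(2))
      (auto intro!: arg_cong2[where f = "(+)"] integral_cong arg_cong2[where f = "h _"] * simp del: delay_iter.simps)
qed

lemma delay_equation_solvable:
  fixes e :: "real \<Rightarrow> real" and h :: "real \<Rightarrow> real \<Rightarrow> real \<Rightarrow> real"
  assumes "continuous_on UNIV e" "continuous_on UNIV (\<lambda>(t, y, q). h t y q)" "\<tau> > 0"
  obtains P where "continuous_on UNIV (\<lambda>(p, x). P p x)"
    "\<And>p x. x \<le> b \<Longrightarrow> P p x = p + integral {a..x} (\<lambda>t.
       h t (integral {a..max a (t - \<tau>)} (\<lambda>s. e s * P p s)) (P p (max a (t - \<tau>))))"
proof -
  obtain j :: nat where "(b - a) / \<tau> \<le> j"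
    using real_arch_simple by blast
  then have j: "b \<le> a + real j * \<tau>"
    using assms(3) by (simp add: field_simps)
  show ?thesis
  proof (rule that)
    show "continuous_on UNIV (\<lambda>(p, x). delay_iter a e h \<tau> j p x)"
      by (rule continuous_delay_iter) fact+
    show "delay_iter a e h \<tau> j p x = p + integral {a..x} (\<lambda>t.
       h t (integral {a..max a (t - \<tau>)} (\<lambda>s. e s * delay_iter a e h \<tau> j p s)) (delay_iter a e h \<tau> j p (max a (t - \<tau>))))"
      if "x \<le> b" for p x
      using delay_iter_stationary[of \<tau> x a j e h p] that j assms(3) by simp
  qed
qed

text \<open>Only \<open>Q\<close> is unknown: \<open>v\<close> is the integral of
  \<open>e * Q\<close> from \<open>a\<close>, so the vanishing integral over \<open>{a..b}\<close>
  is the right boundary condition \<open>v b = 0\<close>.\<close>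

lemma delay_bvp_solvable:
  fixes e :: "real \<Rightarrow> real" and h :: "real \<Rightarrow> real \<Rightarrow> real \<Rightarrow> real"
  assumes e: "continuous_on UNIV e" "\<And>x. e x > 0" and h: "continuous_on UNIV (\<lambda>(t, y, q). h t y q)" 
    and C: "\<And>t y q. \<bar>h t y q\<bar> \<le> C" and "\<tau> > 0" "a < b"
  obtains Q where "continuous_on UNIV Q" "\<bar>Q a\<bar> \<le> C * (b - a)"
    "integral {a..b} (\<lambda>s. e s * Q s) = 0"
    "continuous_on UNIV (\<lambda>t. h t (integral {a..max a (t - \<tau>)} (\<lambda>s. e s * Q s)) (Q (max a (t - \<tau>))))"
    "\<And>x. x \<le> b \<Longrightarrow> Q x = Q a + integral {a..x} (\<lambda>t.
       h t (integral {a..max a (t - \<tau>)} (\<lambda>s. e s * Q s)) (Q (max a (t - \<tau>))))"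
proof -
  obtain P where P: "continuous_on UNIV (\<lambda>(p, x). P p x)" and
    eq: "\<And>p x. x \<le> b \<Longrightarrow> P p x = p + integral {a..x} (\<lambda>t.
       h t (integral {a..max a (t - \<tau>)} (\<lambda>s. e s * P p s)) (P p (max a (t - \<tau>))))"
    using delay_equation_solvable[OF e(1) h \<open>\<tau> > 0\<close>] by blast
  have Pp: "continuous_on UNIV (P p)" for p
    by (rule continuous_on_section) fact
  define R where "R p t = h t (integral {a..max a (t - \<tau>)} (\<lambda>s. e s * P p s)) (P p (max a (t - \<tau>)))" for p t
  have R: "continuous_on UNIV (R p)" for p
    using continuous_on_section[OF continuous_delay_rhs[OF e(1) h P, of a \<tau>]]
    unfolding R_def .
  have bd: "\<bar>P p x - p\<bar> \<le> C * (b - a)" if "x \<in> {a..b}" for p x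
  proof -
    have "\<bar>integral {a..x} (R p)\<bar> \<le> C * (x - a)"
      using integral_bound[of a x "R p" C] that C continuous_on_subset[OF R] by (auto simp: R_def)
    also have "\<dots> \<le> C * (b - a)"
      using that C[of 0 0 0] by (intro mult_left_mono) auto
    finally show ?thesis
      using that eq[of x p] by (simp add: R_def[abs_def])
  qed
  define \<phi> where "\<phi> p = integral {a..b} (\<lambda>s. e s * P p s)" for p
  have int: "(\<lambda>s. e s * P p s) integrable_on {a..b}" for p
    by (intro integrable_continuous_real continuous_intros continuous_on_subset[OF e(1)] continuous_on_subset[OF Pp]) auto
  have cont: "continuous_on UNIV \<phi>"
  proof -
    have "continuous_on UNIV (\<lambda>z::real \<times> real. e (snd z))"
      by (rule continuous_on_compose2[OF e(1)]) (auto intro!: continuous_intros)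
    then have "continuous_on UNIV (\<lambda>(p, s). e s * P p s)"
      using P by (auto intro!: continuous_intros simp: case_prod_beta)
    from continuous_on_compose2[OF continuous_on_integral_upper[OF this, of a], where f = "\<lambda>p. (p, b)"]
    show ?thesis unfolding \<phi>_def by (simp add: continuous_on_Pair)
  qed
  \<comment> \<open>On \<open>[a,b]\<close> the solution \<open>P p\<close> stays within
    \<open>D\<close> of \<open>p\<close>, so it is nonnegative for \<open>p = D\<close> and
    nonpositive for \<open>p = -D\<close>. Hence \<open>\<phi>\<close> changes sign between these
    two slopes.\<close>
  define D where "D = C * (b - a)"
  have "D \<ge> 0"
    using C[of 0 0 0] \<open>a < b\<close> by (auto simp: D_def)
  have "\<phi> D \<ge> 0"
    unfolding \<phi>_def
  proof (rule integral_nonneg[OF int])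
    fix s assume "s \<in> {a..b}"
    then show "0 \<le> e s * P D s" using bd[of s D] e(2)[of s] by (auto simp: D_def)
  qed
  moreover have "\<phi> (-D) \<le> 0"
  proof -
    have "integral {a..b} (\<lambda>s. e s * P (-D) s) \<le> integral {a..b} (\<lambda>s. 0::real)"
    proof (rule integral_le[OF int])
      fix s assume "s \<in> {a..b}"
      then show "e s * P (-D) s \<le> 0" using bd[of s "-D"] e(2)[of s] by (auto simp: D_def mult_le_0_iff)
    qed auto
    then show ?thesis by (simp add: \<phi>_def)
  qed
  ultimately obtain p where p: "-D \<le> p" "p \<le> D" "\<phi> p = 0"
    using IVT'[of \<phi> "-D" 0 D] \<open>D \<ge> 0\<close> continuous_on_subset[OF cont] by auto
  have "P p a = p" using eq[of a p] \<open>a < b\<close> by simp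
  show ?thesis
    by (rule that[of "P p"])
      (use p eq R[of p] in \<open>auto simp: \<open>P p a = p\<close> \<phi>_def D_def Pp R_def\<close>)
qed

section \<open>Letting the delay tend to zero\<close>

lemma continuous_on_Icc_bounded:
  fixes f :: "real \<Rightarrow> real"
  assumes "continuous_on {a..b} f"
  obtains C where "C > 0" "\<And>x. x \<in> {a..b} \<Longrightarrow> \<bar>f x\<bar> \<le> C"
proof -
  have "bounded (f ` {a..b})"
    using compact_continuous_image[OF assms] by (auto intro: compact_imp_bounded)
  then show ?thesis
    using that by (force simp: bounded_pos)
qed

lemma compact_Icc_preimage:
  fixes f :: "real \<Rightarrow> real"
  assumes "continuous_on {a..b} f" "closed T"
  shows "compact ({a..b} \<inter> f -` T)"
  using continuous_closed_preimage[OF assms(1) _ assms(2)]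
  by (auto simp: compact_eq_bounded_closed intro: bounded_subset[of "{a..b}"])

text \<open>The delayed solutions have the common Lipschitz constant \<open>C\<close> and initial
  values bounded by \<open>C * (b - a)\<close>, hence a uniformly convergent subsequence. The
  integral equations, not the differential ones, are passed to the limit by dominated convergence;
  differentiability is recovered afterwards.\<close>

lemma bounded_bvp_solvable:
  fixes e :: "real \<Rightarrow> real" and h :: "real \<Rightarrow> real \<Rightarrow> real \<Rightarrow> real"
  assumes e: "continuous_on UNIV e" "\<And>x. e x > 0" and h: "continuous_on UNIV (\<lambda>(t, y, q). h t y q)" 
    and C: "\<And>t y q. \<bar>h t y q\<bar> \<le> C" and "a < b"
  obtains v Q where "\<And>x. x \<in> {a..b} \<Longrightarrow> (v has_real_derivative e x * Q x) (at x within {a..b})"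
    "\<And>x. x \<in> {a..b} \<Longrightarrow> (Q has_real_derivative h x (v x) (Q x)) (at x within {a..b})"
    "v a = 0" "v b = 0"
proof -
  define \<tau> where "\<tau> n = 1 / real (Suc n)" for n
  define R where "R n Q t = h t (integral {a..max a (t - \<tau> n)} (\<lambda>s. e s * Q s)) (Q (max a (t - \<tau> n)))"
    for n t and Q :: "real \<Rightarrow> real"
  have "\<exists>Q. continuous_on UNIV Q \<and> \<bar>Q a\<bar> \<le> C * (b - a) \<and>
    integral {a..b} (\<lambda>s. e s * Q s) = 0 \<and> continuous_on UNIV (R n Q) \<and>
    (\<forall>x\<le>b. Q x = Q a + integral {a..x} (R n Q))" for n
  proof -
    have "\<tau> n > 0" by (simp add: \<tau>_def)
    show ?thesis
    proof (rule delay_bvp_solvable[OF e h C \<open>\<tau> n > 0\<close> \<open>a < b\<close>])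
      fix Q
      assume "continuous_on UNIV Q" "\<bar>Q a\<bar> \<le> C * (b - a)" "integral {a..b} (\<lambda>s. e s * Q s) = 0"
        "continuous_on UNIV (\<lambda>t. h t (integral {a..max a (t - \<tau> n)} (\<lambda>s. e s * Q s)) (Q (max a (t - \<tau> n))))"
        "\<And>x. x \<le> b \<Longrightarrow> Q x = Q a + integral {a..x} (\<lambda>t.
           h t (integral {a..max a (t - \<tau> n)} (\<lambda>s. e s * Q s)) (Q (max a (t - \<tau> n))))"
      then show ?thesis
        unfolding R_def[abs_def] by blast
    qed
  qed
  then obtain Q where Q: "\<And>n. continuous_on UNIV (Q n)" "\<And>n. \<bar>Q n a\<bar> \<le> C * (b - a)"
    "\<And>n. integral {a..b} (\<lambda>s. e s * Q n s) = 0" "\<And>n. continuous_on UNIV (R n (Q n))"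
    "\<And>n x. x \<le> b \<Longrightarrow> Q n x = Q n a + integral {a..x} (R n (Q n))"
    by metis
  have "C \<ge> 0" using C[of 0 0 0] by linarith
  have lip1: "\<bar>Q n y - Q n x\<bar> \<le> C * (y - x)" if "a \<le> x" "x \<le> y" "y \<le> b" for n x y
  proof -
    have "integral {a..y} (R n (Q n)) = integral {a..x} (R n (Q n)) + integral {x..y} (R n (Q n))"
      using that integrable_continuous_real[OF continuous_on_subset[OF Q(4)]] by (simp add: Henstock_Kurzweil_Integration.integral_combine)
    then have "Q n y - Q n x = integral {x..y} (R n (Q n))"
      using Q(5)[of y n] Q(5)[of x n] that by simp
    moreover have "\<bar>integral {x..y} (R n (Q n))\<bar> \<le> C * (y - x)"
      using integral_bound[of x y "R n (Q n)" C] that continuous_on_subset[OF Q(4)] C by (auto simp: R_def)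
    ultimately show ?thesis by simp
  qed
  have lip: "\<bar>Q n y - Q n x\<bar> \<le> C * \<bar>y - x\<bar>" if "x \<in> {a..b}" "y \<in> {a..b}" for n x y
    using lip1[of x y n] lip1[of y x n] that by (cases "x \<le> y") (auto simp: abs_minus_commute)
  \<comment> \<open>One \<open>C * (b - a)\<close> bounds the initial value, the other the variation
    over \<open>[a,b]\<close>.\<close>
  have bd: "norm (Q n x) \<le> 2 * C * (b - a)" if "x \<in> {a..b}" for n x
  proof -
    have "\<bar>Q n x - Q n a\<bar> \<le> C * (b - a)"
      using lip1[of a x n] mult_left_mono[of "x - a" "b - a" C] that \<open>C \<ge> 0\<close> by auto
    then show ?thesis using Q(2)[of n] by auto
  qed
  obtain g k where g: "continuous_on {a..b} g" and k: "strict_mono (k :: nat \<Rightarrow> nat)"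
    and lim: "\<And>e. 0 < e \<Longrightarrow> \<exists>N. \<forall>n x. n \<ge> N \<and> x \<in> {a..b} \<longrightarrow> norm (Q (k n) x - g x) < e"
  proof (rule Arzela_Ascoli[of "{a..b}" Q "2 * C * (b - a)"])
    show "\<exists>d>0. \<forall>n y. y \<in> {a..b} \<and> norm (x - y) < d \<longrightarrow> norm (Q n x - Q n y) < \<epsilon>"
      if "x \<in> {a..b}" "0 < \<epsilon>" for x \<epsilon>
    proof (intro exI[of _ "\<epsilon> / (C + 1)"] conjI allI impI)
      fix n y assume y: "y \<in> {a..b} \<and> norm (x - y) < \<epsilon> / (C + 1)"
      have "\<bar>Q n x - Q n y\<bar> \<le> C * \<bar>x - y\<bar>" using lip y that by blast
      also have "\<dots> \<le> (C + 1) * \<bar>x - y\<bar>" by (simp add: distrib_right)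
      also have "\<dots> < \<epsilon>" using y \<open>C \<ge> 0\<close> by (simp add: field_simps)
      finally show "norm (Q n x - Q n y) < \<epsilon>" by simp
    qed (use \<open>0 < \<epsilon>\<close> \<open>C \<ge> 0\<close> in auto)
  qed (use bd in auto)
  have lim': "(\<lambda>n. Q (k n) x) \<longlonglongrightarrow> g x" if "x \<in> {a..b}" for x
    unfolding LIMSEQ_iff using lim that by blast
  define v where "v x = integral {a..x} (\<lambda>s. e s * g s)" for x
  have eQ: "(\<lambda>s. e s * Q n s) integrable_on {c..d}" for n c d
    by (intro integrable_continuous_real continuous_intros continuous_on_subset[OF e(1)] continuous_on_subset[OF Q(1)]) auto
  obtain E where E: "\<And>x. x \<in> {a..b} \<Longrightarrow> \<bar>e x\<bar> \<le> E"
    using continuous_on_Icc_bounded[OF continuous_on_subset[OF e(1) subset_UNIV]] by metis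
  have v_lim: "(\<lambda>n. integral {a..x} (\<lambda>s. e s * Q (k n) s)) \<longlonglongrightarrow> v x" if "x \<in> {a..b}" for x
    unfolding v_def
  proof (rule dominated_convergence(2)[OF eQ, where h = "\<lambda>_. E * (2 * C * (b - a))"])
    fix n s assume s: "s \<in> {a..x}"
    show "norm (e s * Q (k n) s) \<le> E * (2 * C * (b - a))"
      unfolding norm_mult using E[of s] bd[of s "k n"] s that
      by (intro mult_mono) auto
    show "(\<lambda>n. e s * Q (k n) s) \<longlonglongrightarrow> e s * g s"
      using s that by (intro tendsto_intros lim') auto
  qed auto
  have \<tau>_lim: "(\<lambda>n. \<tau> (k n)) \<longlonglongrightarrow> 0"
    using LIMSEQ_subseq_LIMSEQ[OF LIMSEQ_inverse_real_of_nat k] by (simp add: \<tau>_def inverse_eq_divide o_def)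
  have t_lim: "(\<lambda>n. max a (t - \<tau> (k n))) \<longlonglongrightarrow> t" if "t \<in> {a..b}" for t
  proof -
    have "(\<lambda>n. max a (t - \<tau> (k n))) \<longlonglongrightarrow> max a (t - 0)"
      by (intro tendsto_intros \<tau>_lim)
    then show ?thesis using that by simp
  qed
  \<comment> \<open>The evaluation point moves with \<open>n\<close> too; the Lipschitz constant
    common to all \<open>Q n\<close> reduces this to the limit at the fixed point
    \<open>t\<close>.\<close>
  have Q_lim: "(\<lambda>n. Q (k n) (max a (t - \<tau> (k n)))) \<longlonglongrightarrow> g t" if "t \<in> {a..b}" for t
  proof -
    have "(\<lambda>n. C * \<bar>max a (t - \<tau> (k n)) - t\<bar>) \<longlonglongrightarrow> C * \<bar>t - t\<bar>"
      by (intro tendsto_intros t_lim that)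
    then have "(\<lambda>n. C * \<bar>max a (t - \<tau> (k n)) - t\<bar>) \<longlonglongrightarrow> 0" by simp
    moreover have "norm (Q (k n) (max a (t - \<tau> (k n))) - Q (k n) t) \<le> C * \<bar>max a (t - \<tau> (k n)) - t\<bar>" for n
    proof -
      have "\<tau> (k n) \<ge> 0" by (simp add: \<tau>_def)
      then show ?thesis using lip[of t "max a (t - \<tau> (k n))" "k n"] that by auto
    qed
    ultimately have "(\<lambda>n. Q (k n) (max a (t - \<tau> (k n))) - Q (k n) t) \<longlonglongrightarrow> 0"
      by - (rule Lim_null_comparison[OF always_eventually, rotated], assumption, blast)
    from tendsto_add[OF this lim'[OF that]] show ?thesis by simp
  qed
  have I_lim: "(\<lambda>n. integral {a..max a (t - \<tau> (k n))} (\<lambda>s. e s * Q (k n) s)) \<longlonglongrightarrow> v t"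
    if t: "t \<in> {a..b}" for t
  proof -
    let ?m = "\<lambda>n. max a (t - \<tau> (k n))"
    let ?D = "E * (2 * C * (b - a))"
    have "\<bar>integral {a..?m n} (\<lambda>s. e s * Q (k n) s) - integral {a..t} (\<lambda>s. e s * Q (k n) s)\<bar> \<le> ?D * \<bar>?m n - t\<bar>" for n
    proof -
      have m: "a \<le> ?m n" "?m n \<le> t" using t by (auto simp: \<tau>_def)
      have "integral {a..t} (\<lambda>s. e s * Q (k n) s) = integral {a..?m n} (\<lambda>s. e s * Q (k n) s) + integral {?m n..t} (\<lambda>s. e s * Q (k n) s)"
        using m eQ by (simp add: Henstock_Kurzweil_Integration.integral_combine)
      moreover have "\<bar>integral {?m n..t} (\<lambda>s. e s * Q (k n) s)\<bar> \<le> ?D * (t - ?m n)"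
      proof -
        have "norm (e s * Q (k n) s) \<le> ?D" if "s \<in> {?m n..t}" for s
          unfolding norm_mult using E[of s] bd[of s "k n"] that m t by (intro mult_mono) auto
        moreover have "continuous_on {?m n..t} (\<lambda>s. e s * Q (k n) s)"
          by (intro continuous_intros continuous_on_subset[OF e(1)] continuous_on_subset[OF Q(1)]) auto
        ultimately show ?thesis
          using integral_bound[of "?m n" t "\<lambda>s. e s * Q (k n) s" ?D] m by simp
      qed
      ultimately show ?thesis using m by simp
    qed
    moreover have "(\<lambda>n. ?D * \<bar>?m n - t\<bar>) \<longlonglongrightarrow> ?D * \<bar>t - t\<bar>"
      by (intro tendsto_intros t_lim that)
    ultimately have "(\<lambda>n. integral {a..?m n} (\<lambda>s. e s * Q (k n) s) - integral {a..t} (\<lambda>s. e s * Q (k n) s)) \<longlonglongrightarrow> 0"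
      by - (rule Lim_null_comparison[OF always_eventually, rotated], simp, simp)
    from tendsto_add[OF this v_lim[OF that]] show ?thesis by simp
  qed
  have R_lim: "(\<lambda>n. R (k n) (Q (k n)) t) \<longlonglongrightarrow> h t (v t) (g t)" if "t \<in> {a..b}" for t
  proof -
    have "isCont (\<lambda>(t, y, q). h t y q) (t, v t, g t)"
      using h by (simp add: continuous_on_eq_continuous_at)
    then show ?thesis
      using isCont_tendsto_compose[OF _ tendsto_Pair[OF tendsto_const[of t] tendsto_Pair[OF I_lim[OF that] Q_lim[OF that]]]]
      unfolding R_def by fastforce
  qed
  have Qeq: "g x = g a + integral {a..x} (\<lambda>t. h t (v t) (g t))" if x: "x \<in> {a..b}" for x
  proof -
    have "(\<lambda>n. integral {a..x} (R (k n) (Q (k n)))) \<longlonglongrightarrow> integral {a..x} (\<lambda>t. h t (v t) (g t))"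
    proof (rule dominated_convergence(2)[where h = "\<lambda>_. C"])
      show "R (k n) (Q (k n)) integrable_on {a..x}" for n
        by (intro integrable_continuous_real continuous_on_subset[OF Q(4)]) auto
    qed (use x R_lim C in \<open>auto simp: R_def\<close>)
    then have "(\<lambda>n. Q (k n) a + integral {a..x} (R (k n) (Q (k n)))) \<longlonglongrightarrow> g a + integral {a..x} (\<lambda>t. h t (v t) (g t))"
      using \<open>a < b\<close> by (intro tendsto_add lim') auto
    then show ?thesis
      using LIMSEQ_unique[OF lim'[OF x]] Q(5)[of x] x by simp
  qed
  have dv: "(v has_real_derivative e x * g x) (at x within {a..b})" if "x \<in> {a..b}" for x
    using integral_has_real_derivative[of a b "\<lambda>s. e s * g s" x] that g continuous_on_subset[OF e(1)]
    by (auto simp: v_def[abs_def] intro!: continuous_intros)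
  then have "continuous_on {a..b} v"
    by (rule DERIV_continuous_on)
  then have "continuous_on {a..b} (\<lambda>t. (t, v t, g t))"
    using g by (intro continuous_intros)
  from continuous_on_compose2[OF h this] have "continuous_on {a..b} (\<lambda>t. h t (v t) (g t))"
    by simp
  note dR = integral_has_real_derivative[OF this]
  have "(g has_real_derivative h x (v x) (g x)) (at x within {a..b})" if x: "x \<in> {a..b}" for x
  proof (rule has_field_derivative_transform_within[OF _ zero_less_one x])
    show "((\<lambda>x. g a + integral {a..x} (\<lambda>t. h t (v t) (g t))) has_real_derivative h x (v x) (g x)) (at x within {a..b})"
      using dR[OF x] by (auto intro!: derivative_eq_intros)
    show "g a + integral {a..x} (\<lambda>t. h t (v t) (g t)) = g x" if "x \<in> {a..b}" for x
      by (rule Qeq[OF that, symmetric])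
  qed
  moreover have "v b = 0"
    using v_lim[of b] Q(3) \<open>a < b\<close> by (simp add: LIMSEQ_const_iff)
  moreover have "v a = 0" by (simp add: v_def)
  ultimately show ?thesis using that dv by blast
qed

subsection \<open>Comparison\<close>

text \<open>The sign is asked for in the open interval only, because the differential inequalities
  below may fail at the end where a function changes sign.\<close>

lemma DERIV_within_increasing:
  fixes f :: "real \<Rightarrow> real"
  assumes "a \<le> b" "\<And>x. x \<in> {a..b} \<Longrightarrow> (f has_real_derivative f' x) (at x within {a..b})"
    "\<And>x. a < x \<Longrightarrow> x < b \<Longrightarrow> f' x \<ge> 0"
  shows "f a \<le> f b"
proof (rule DERIV_nonneg_imp_increasing_open[OF assms(1)])
  show "\<exists>y. (f has_real_derivative y) (at x) \<and> 0 \<le> y" if "a < x" "x < b" for x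
    using assms(2)[of x] assms(3)[of x] that at_within_Icc_at[of a x b] by auto
  show "continuous_on {a..b} f"
    by (rule DERIV_continuous_on) (rule assms(2))
qed

text \<open>Only the stretch after the last point \<open>y\<close> with \<open>f y \<ge> 0\<close>
  matters. There \<open>\<bar>f x\<bar> = - f x\<close>, so the inequality becomes the linear one
  \<open>f' x - K * f x \<ge> - \<rho>\<close>, which the factor \<open>exp (- K * x)\<close>
  integrates.\<close>

lemma gronwall_lower:
  fixes f :: "real \<Rightarrow> real"
  assumes "s \<le> t" "K \<ge> 0" "\<rho> \<ge> 0" and f: "\<And>x. x \<in> {s..t} \<Longrightarrow> (f has_real_derivative f' x) (at x within {s..t})"
    and ge: "\<And>x. s < x \<Longrightarrow> x < t \<Longrightarrow> f' x \<ge> - \<rho> - K * \<bar>f x\<bar>" and "f s \<ge> 0"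
  shows "f t \<ge> - (\<rho> * (t - s) * exp (K * (t - s)))"
proof (cases "f t \<ge> 0")
  case True
  then show ?thesis using assms(1-3) by (auto intro: order_trans[of _ 0])
next
  case False
  have cont: "continuous_on {s..t} f" by (rule DERIV_continuous_on) (rule f)
  define Z where "Z = {s..t} \<inter> f -` {0..}"
  have "compact Z" unfolding Z_def
    by (intro compact_Icc_preimage) (auto simp: cont)
  moreover have "s \<in> Z" using assms by (auto simp: Z_def)
  ultimately obtain y where y: "y \<in> Z" "\<And>x. x \<in> Z \<Longrightarrow> x \<le> y"
    using compact_attains_sup[of Z] by auto
  then have y': "s \<le> y" "y \<le> t" "f y \<ge> 0" by (auto simp: Z_def)
  have neg: "f x < 0" if "y < x" "x \<le> t" for x
    using y(2)[of x] that y' by (force simp: Z_def)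
  \<comment> \<open>The linear term compensates the possible decrease of
    \<open>exp (- K * x) * f x\<close>, whose rate is at most
    \<open>\<rho> * exp (- K * x) \<le> \<rho> * exp (- K * s)\<close>.\<close>
  define g where "g x = exp (- K * x) * f x + \<rho> * exp (- K * s) * x" for x
  have "g y \<le> g t"
  proof (rule DERIV_within_increasing[where f = g and a = y and b = t and f' = "\<lambda>x. exp (- K * x) * (f' x - K * f x) + \<rho> * exp (- K * s)"])
    show "(g has_real_derivative exp (- K * x) * (f' x - K * f x) + \<rho> * exp (- K * s)) (at x within {y..t})"
      if "x \<in> {y..t}" for x
      unfolding g_def using that y'
      by (auto intro!: derivative_eq_intros DERIV_subset[OF f] simp: algebra_simps)
    fix x assume x: "y < x" "x < t"
    have "f' x - K * f x \<ge> - \<rho>" using ge[of x] neg[of x] x y' by simp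
    then have "exp (- K * x) * (f' x - K * f x) \<ge> exp (- K * x) * (- \<rho>)"
      by (intro mult_left_mono) auto
    moreover have "exp (- K * x) * \<rho> \<le> exp (- K * s) * \<rho>"
      using x y' assms by (intro mult_right_mono) (auto intro: mult_left_mono)
    ultimately show "exp (- K * x) * (f' x - K * f x) + \<rho> * exp (- K * s) \<ge> 0" by (simp add: algebra_simps)
  qed fact
  then have "exp (- K * t) * f t \<ge> exp (- K * y) * f y - \<rho> * exp (- K * s) * (t - y)"
    by (simp add: g_def algebra_simps)
  moreover have "exp (- K * y) * f y \<ge> 0" using y' by simp
  moreover have "\<rho> * exp (- K * s) * (t - y) \<le> \<rho> * exp (- K * s) * (t - s)"
    using y' assms by (intro mult_left_mono) auto
  ultimately have "exp (- K * t) * f t \<ge> - (\<rho> * exp (- K * s) * (t - s))"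
    by linarith
  then have "exp (K * t) * (exp (- K * t) * f t) \<ge> exp (K * t) * (- (\<rho> * exp (- K * s) * (t - s)))"
    by (intro mult_left_mono) auto
  then show ?thesis
    by (simp add: exp_minus field_simps exp_diff)
qed

text \<open>At a positive maximum \<open>m\<close> the derivative \<open>e m * R m\<close> vanishes,
  so \<open>R m = 0\<close>. As long as \<open>d\<close> stays positive to the right of
  \<open>m\<close>, Gronwall keeps \<open>R\<close> above \<open>- \<rho> * L * exp (K * L)\<close>
  with \<open>L = b - a\<close>. So \<open>d\<close> can lose at most \<open>E * L\<close> times
  this quantity before reaching a value \<open>\<le> 0\<close>, which bounds
  \<open>d m\<close>.\<close>

lemma comparison:
  fixes d R e :: "real \<Rightarrow> real"
  assumes "a \<le> b" "K \<ge> 0" "\<rho> \<ge> 0" and e: "\<And>x. x \<in> {a..b} \<Longrightarrow> 0 < e x" "\<And>x. x \<in> {a..b} \<Longrightarrow> e x \<le> E"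
    and d: "\<And>x. x \<in> {a..b} \<Longrightarrow> (d has_real_derivative e x * R x) (at x within {a..b})"
    and R: "\<And>x. x \<in> {a..b} \<Longrightarrow> (R has_real_derivative R' x) (at x within {a..b})"
    and ge: "\<And>x. x \<in> {a..b} \<Longrightarrow> d x > 0 \<Longrightarrow> R' x \<ge> - \<rho> - K * \<bar>R x\<bar>"
    and bc: "d a \<le> 0" "d b \<le> 0" and x: "x \<in> {a..b}"
  shows "d x \<le> E * \<rho> * (b - a)\<^sup>2 * exp (K * (b - a))"
proof (rule ccontr)
  define L where "L = b - a"
  assume "\<not> ?thesis"
  then have gt: "d x > E * (\<rho> * L * exp (K * L)) * L"
    by (simp add: L_def power2_eq_square mult_ac)
  have nonneg: "\<rho> * L * exp (K * L) \<ge> 0" "E > 0" using assms(1-3) e[OF x] by (auto simp: L_def)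
  have cont: "continuous_on {a..b} d" by (rule DERIV_continuous_on) (rule d)
  obtain m where m: "m \<in> {a..b}" "\<And>y. y \<in> {a..b} \<Longrightarrow> d y \<le> d m"
    using continuous_attains_sup[OF _ _ cont] x by auto
  have dm: "d m > E * (\<rho> * L * exp (K * L)) * L" using gt m(2)[OF x] by simp
  moreover have "E * (\<rho> * L * exp (K * L)) * L \<ge> 0" using nonneg assms(1) by (auto simp: L_def)
  ultimately have "d m > 0" by linarith
  with bc m(1) have mab: "a < m" "m < b" by (auto simp: less_le)
  have "R m = 0"
  proof -
    have "(d has_real_derivative e m * R m) (at m)"
      using d[OF m(1)] at_within_Icc_at[OF mab] by simp
    then have "e m * R m = 0"
      by (rule DERIV_local_max[where d = "min (m - a) (b - m)"])
        (use mab m(2) in \<open>auto simp: abs_less_iff\<close>)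
    then show ?thesis using e(1)[OF m(1)] by simp
  qed
  \<comment> \<open>The first point \<open>y\<close> to the right of \<open>m\<close> with
    \<open>d y \<le> 0\<close>: the inequality for \<open>R'\<close> is available only before
    it.\<close>
  define Z where "Z = {m..b} \<inter> d -` {..0}"
  have "compact Z" unfolding Z_def
    by (intro compact_Icc_preimage) (use mab in \<open>auto intro: continuous_on_subset[OF cont]\<close>)
  moreover have "b \<in> Z" using bc mab by (auto simp: Z_def)
  ultimately obtain y where y: "y \<in> Z" "\<And>x. x \<in> Z \<Longrightarrow> y \<le> x"
    using compact_attains_inf[of Z] by auto
  then have y': "m \<le> y" "y \<le> b" "d y \<le> 0" by (auto simp: Z_def)
  have pos: "d x > 0" if "m \<le> x" "x < y" for x
    using y(2)[of x] that y' by (force simp: Z_def)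
  have Rge: "R z \<ge> - (\<rho> * L * exp (K * L))" if z: "z \<in> {m..y}" for z
  proof -
    have "R z \<ge> - (\<rho> * (z - m) * exp (K * (z - m)))"
    proof (rule gronwall_lower)
      show "R' x \<ge> - \<rho> - K * \<bar>R x\<bar>" if "m < x" "x < z" for x
        using ge[of x] pos[of x] that z y' mab by auto
    qed (use z y' mab \<open>R m = 0\<close> assms in \<open>auto intro!: DERIV_subset[OF R]\<close>)
    moreover have "\<rho> * (z - m) * exp (K * (z - m)) \<le> \<rho> * L * exp (K * L)"
      using z y' mab assms by (intro mult_mono) (auto simp: L_def intro!: mult_left_mono)
    ultimately show ?thesis by linarith
  qed
  \<comment> \<open>The largest rate at which \<open>d\<close> can fall on \<open>[m,y]\<close>, so
    \<open>d z + G * z\<close> is nondecreasing there.\<close>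
  define G where "G = E * (\<rho> * L * exp (K * L))"
  have "d m + G * m \<le> d y + G * y"
  proof (rule DERIV_within_increasing[where f = "\<lambda>z. d z + G * z" and a = m and b = y and f' = "\<lambda>x. e x * R x + G"])
    show "((\<lambda>z. d z + G * z) has_real_derivative e x * R x + G) (at x within {m..y})" if "x \<in> {m..y}" for x
      using that y' mab by (auto intro!: derivative_eq_intros DERIV_subset[OF d])
    show "e x * R x + G \<ge> 0" if "m < x" "x < y" for x
    proof -
      have ex: "0 < e x" "e x \<le> E" using e[of x] that mab y' by auto
      have "e x * R x \<ge> e x * (- (\<rho> * L * exp (K * L)))"
        using Rge[of x] that ex by (intro mult_left_mono) auto
      moreover have "e x * (\<rho> * L * exp (K * L)) \<le> G"
        unfolding G_def using ex nonneg by (intro mult_right_mono) auto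
      ultimately show ?thesis by simp
    qed
  qed fact
  then have "d m \<le> d y + G * (y - m)" by (simp add: algebra_simps)
  moreover have "G * (y - m) \<le> G * L"
    using nonneg y' mab by (intro mult_left_mono) (auto simp: G_def L_def)
  ultimately show False using y'(3) dm by (simp add: G_def)
qed

subsection \<open>The boundary value problem for a first-order system\<close>

text \<open>This is \<open>comparison\<close> with \<open>\<rho> = 0\<close>, applied to
  \<open>v - w\<close> and to \<open>w - v\<close>. Where \<open>v > w\<close>, monotonicity gives
  \<open>H x (v x) (Q x) \<ge> H x (w x) (Q x)\<close>, and replacing \<open>Q x\<close> by
  \<open>P x\<close> costs at most \<open>K * \<bar>Q x - P x\<bar>\<close>.\<close>

lemma first_order_bvp_unique:
  fixes e :: "real \<Rightarrow> real" and H :: "real \<Rightarrow> real \<Rightarrow> real \<Rightarrow> real"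
  assumes "a \<le> b" "K \<ge> 0" and e: "continuous_on {a..b} e" "\<And>x. e x > 0"
    and mono: "\<And>x y y' q. x \<in> {a..b} \<Longrightarrow> y \<le> y' \<Longrightarrow> H x y q \<le> H x y' q"
    and lip: "\<And>x y q q'. x \<in> {a..b} \<Longrightarrow> \<bar>H x y q - H x y q'\<bar> \<le> K * \<bar>q - q'\<bar>"
    and v: "\<And>x. x \<in> {a..b} \<Longrightarrow> (v has_real_derivative e x * Q x) (at x within {a..b})"
    and Q: "\<And>x. x \<in> {a..b} \<Longrightarrow> (Q has_real_derivative H x (v x) (Q x)) (at x within {a..b})"
    and w: "\<And>x. x \<in> {a..b} \<Longrightarrow> (w has_real_derivative e x * P x) (at x within {a..b})"
    and P: "\<And>x. x \<in> {a..b} \<Longrightarrow> (P has_real_derivative H x (w x) (P x)) (at x within {a..b})"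
    and bc: "v a = w a" "v b = w b" and x: "x \<in> {a..b}"
  shows "v x = w x"
proof -
  obtain E where E: "\<And>x. x \<in> {a..b} \<Longrightarrow> \<bar>e x\<bar> \<le> E"
    using continuous_on_Icc_bounded[OF e(1)] by metis
  have E': "e x \<le> E" if "x \<in> {a..b}" for x using E[OF that] by linarith
  have le: "v x \<le> w x" if v: "\<And>x. x \<in> {a..b} \<Longrightarrow> (v has_real_derivative e x * Q x) (at x within {a..b})"
    and Q: "\<And>x. x \<in> {a..b} \<Longrightarrow> (Q has_real_derivative H x (v x) (Q x)) (at x within {a..b})"
    and w: "\<And>x. x \<in> {a..b} \<Longrightarrow> (w has_real_derivative e x * P x) (at x within {a..b})"
    and P: "\<And>x. x \<in> {a..b} \<Longrightarrow> (P has_real_derivative H x (w x) (P x)) (at x within {a..b})"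
    and bc: "v a = w a" "v b = w b" for v Q w P
  proof -
    have "v x - w x \<le> E * 0 * (b - a)\<^sup>2 * exp (K * (b - a))"
    proof (rule comparison[where R = "\<lambda>x. Q x - P x" and R' = "\<lambda>x. H x (v x) (Q x) - H x (w x) (P x)" and d = "\<lambda>x. v x - w x" and e = e])
      show "((\<lambda>x. v x - w x) has_real_derivative e x * (Q x - P x)) (at x within {a..b})" if "x \<in> {a..b}" for x
        using that by (auto intro!: derivative_eq_intros v w simp: algebra_simps)
      show "- 0 - K * \<bar>Q x - P x\<bar> \<le> H x (v x) (Q x) - H x (w x) (P x)" if "x \<in> {a..b}" "0 < v x - w x" for x
        using mono[OF that(1), of "w x" "v x" "Q x"] lip[OF that(1), of "w x" "Q x" "P x"] that(2) by linarith
    qed (use assms(1,2) e E' bc x in \<open>auto intro!: derivative_eq_intros Q P\<close>)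
    then show ?thesis by simp
  qed
  show ?thesis
    using le[OF v Q w P bc] le[OF w P v Q bc[symmetric]] by simp
qed

text \<open>To the right of the zero, the one-sided estimate is applied to \<open>f\<close> and
  \<open>- f\<close>; the left side is brought to this case by the reflection of the
  variable.\<close>

lemma gronwall_zero:
  fixes f :: "real \<Rightarrow> real"
  assumes "K \<ge> 0" "\<rho> \<ge> 0" and f: "\<And>x. x \<in> {a..b} \<Longrightarrow> (f has_real_derivative f' x) (at x within {a..b})"
    and le: "\<And>x. x \<in> {a..b} \<Longrightarrow> \<bar>f' x\<bar> \<le> \<rho> + K * \<bar>f x\<bar>" and z: "z \<in> {a..b}" "f z = 0" and x: "x \<in> {a..b}"
  shows "\<bar>f x\<bar> \<le> \<rho> * (b - a) * exp (K * (b - a))"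
proof -
  have mono: "\<rho> * (t - s) * exp (K * (t - s)) \<le> \<rho> * (b - a) * exp (K * (b - a))" if "a \<le> s" "s \<le> t" "t \<le> b" for s t
    using that assms(1,2) by (intro mult_mono) (auto intro!: mult_left_mono)
  show ?thesis
  proof (cases "z \<le> x")
    case True
    have sub: "{z..x} \<subseteq> {a..b}" using z x by auto
    have le': "- \<rho> - K * \<bar>f y\<bar> \<le> f' y" "- \<rho> - K * \<bar>- f y\<bar> \<le> - f' y" if "z < y" "y < x" for y
      using le[of y] that z x by auto
    have "f x \<ge> - (\<rho> * (x - z) * exp (K * (x - z)))"
      by (rule gronwall_lower[where f' = f', OF True assms(1,2) DERIV_subset[OF f sub]])
        (use le' z x in auto)
    moreover have "- f x \<ge> - (\<rho> * (x - z) * exp (K * (x - z)))"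
    proof (rule gronwall_lower[where f' = "\<lambda>x. - f' x" and f = "\<lambda>x. - f x", OF True assms(1,2)])
      show "((\<lambda>x. - f x) has_real_derivative - f' y) (at y within {z..x})" if "y \<in> {z..x}" for y
        using that sub by (intro derivative_intros DERIV_subset[OF f sub]) auto
    qed (use le' z in auto)
    ultimately show ?thesis using mono[of z x] True z x by auto
  next
    case False
    then have neg: "- z \<le> - x" by simp
    have rev: "((\<lambda>x. f (- x)) has_real_derivative - f' (- y)) (at y within {-z..-x})" if "y \<in> {-z..-x}" for y
    proof -
      have "(f has_real_derivative f' (- y)) (at (- y) within uminus ` {-z..-x})"
        by (rule DERIV_subset[OF f]) (use that z x in auto)
      from DERIV_image_chain[OF this, of "- 1"] show ?thesis
        by (simp add: o_def DERIV_minus[OF DERIV_ident, simplified])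
    qed
    have le': "- \<rho> - K * \<bar>f (- y)\<bar> \<le> - f' (- y)" "- \<rho> - K * \<bar>- f (- y)\<bar> \<le> f' (- y)"
      if "- z < y" "y < - x" for y
      using le[of "- y"] that z x by auto
    have "f (- (- x)) \<ge> - (\<rho> * (- x - - z) * exp (K * (- x - - z)))"
      by (rule gronwall_lower[where f' = "\<lambda>y. - f' (- y)" and f = "\<lambda>x. f (- x)", OF neg assms(1,2) rev])
        (use le' z in auto)
    moreover have "- f (- (- x)) \<ge> - (\<rho> * (- x - - z) * exp (K * (- x - - z)))"
    proof (rule gronwall_lower[where f' = "\<lambda>y. f' (- y)" and f = "\<lambda>x. - f (- x)", OF neg assms(1,2)])
      show "((\<lambda>x. - f (- x)) has_real_derivative f' (- y)) (at y within {-z..-x})" if "y \<in> {-z..-x}" for y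
        using DERIV_minus[OF rev[OF that]] by simp
    qed (use le' z in auto)
    ultimately show ?thesis using mono[of x z] False z x by auto
  qed
qed

text \<open>The truncation levels are not circular: \<open>M\<close> is built from a bound for
  \<open>H x 0 0\<close>, and \<open>Z\<close> from a bound for \<open>H x y 0\<close> with
  \<open>\<bar>y\<bar> \<le> M\<close>. Clamping is nondecreasing and Lipschitz with constant 1, so
  the truncated \<open>G\<close> keeps the monotonicity and the constant \<open>K\<close>, and the
  bounds apply to its solutions.\<close>

lemma first_order_bvp_exists:
  fixes e :: "real \<Rightarrow> real" and H :: "real \<Rightarrow> real \<Rightarrow> real \<Rightarrow> real"
  assumes "a < b" "K \<ge> 0" and e: "continuous_on UNIV e" "\<And>x. e x > 0"
    and H: "continuous_on ({a..b} \<times> UNIV) (\<lambda>(x, y, q). H x y q)"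
    and mono: "\<And>x y y' q. x \<in> {a..b} \<Longrightarrow> y \<le> y' \<Longrightarrow> H x y q \<le> H x y' q"
    and lip: "\<And>x y q q'. x \<in> {a..b} \<Longrightarrow> \<bar>H x y q - H x y q'\<bar> \<le> K * \<bar>q - q'\<bar>"
  obtains v Q where
    "\<And>x. x \<in> {a..b} \<Longrightarrow> (v has_real_derivative e x * Q x) (at x within {a..b})"
    "\<And>x. x \<in> {a..b} \<Longrightarrow> (Q has_real_derivative H x (v x) (Q x)) (at x within {a..b})"
    "v a = 0" "v b = 0"
proof -
  obtain E where "E > 0" and E: "\<And>x. x \<in> {a..b} \<Longrightarrow> \<bar>e x\<bar> \<le> E"
    using continuous_on_Icc_bounded[OF continuous_on_subset[OF e(1) subset_UNIV]] by metis
  have E': "e x \<le> E" if "x \<in> {a..b}" for x using E[OF that] by linarith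
  have bdd: "\<exists>C. \<forall>x\<in>{a..b}. \<forall>y\<in>{-M..M}. \<forall>q\<in>{-Z..Z}. \<bar>H x y q\<bar> \<le> C" for M Z
  proof -
    have "compact ((\<lambda>(x, y, q). H x y q) ` ({a..b} \<times> {-M..M} \<times> {-Z..Z}))"
      by (intro compact_continuous_image continuous_on_subset[OF H] compact_Times) auto
    then show ?thesis
      by (auto dest!: compact_imp_bounded simp: bounded_iff)
  qed
  obtain h0 where h0: "\<And>x. x \<in> {a..b} \<Longrightarrow> \<bar>H x 0 0\<bar> \<le> h0"
    using bdd[of 0 0] by (metis atLeastAtMost_iff minus_zero order_refl)
  have "h0 \<ge> 0" using h0[of a] \<open>a < b\<close> by auto
  define M where "M = E * h0 * (b - a)\<^sup>2 * exp (K * (b - a))"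
  have "M \<ge> 0" using \<open>E > 0\<close> \<open>h0 \<ge> 0\<close> by (auto simp: M_def)
  obtain h1 where h1: "\<And>x y. x \<in> {a..b} \<Longrightarrow> y \<in> {-M..M} \<Longrightarrow> \<bar>H x y 0\<bar> \<le> h1"
    using bdd[of M 0] by (metis atLeastAtMost_iff minus_zero order_refl)
  have "h1 \<ge> 0" using h1[of a 0] \<open>a < b\<close> \<open>M \<ge> 0\<close> by auto
  define Z where "Z = h1 * (b - a) * exp (K * (b - a))"
  have "Z \<ge> 0" using \<open>a < b\<close> \<open>h1 \<ge> 0\<close> by (auto simp: Z_def)
  obtain C where C: "\<And>x y q. x \<in> {a..b} \<Longrightarrow> y \<in> {-M..M} \<Longrightarrow> q \<in> {-Z..Z} \<Longrightarrow> \<bar>H x y q\<bar> \<le> C"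
    using bdd[of M Z] by blast
  \<comment> \<open>\<open>M\<close> and \<open>Z\<close> bound every solution of the problem truncated at these same levels, so the
    truncation is invisible to the solution found.\<close>
  define G where "G t y q = H (max a (min b t)) (max (-M) (min M y)) (max (-Z) (min Z q))" for t y q
  have G_bd: "\<bar>G t y q\<bar> \<le> C" for t y q
    unfolding G_def by (rule C) (use \<open>a < b\<close> \<open>M \<ge> 0\<close> \<open>Z \<ge> 0\<close> in auto)
  have G_cont: "continuous_on UNIV (\<lambda>(t, y, q). G t y q)"
  proof -
    have cont: "continuous_on UNIV (\<lambda>z::real \<times> real \<times> real. (max a (min b (fst z)), max (-M) (min M (fst (snd z))), max (-Z) (min Z (snd (snd z)))))"
      by (intro continuous_intros)
    have range: "range (\<lambda>z::real \<times> real \<times> real. (max a (min b (fst z)), max (-M) (min M (fst (snd z))), max (-Z) (min Z (snd (snd z)))))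
        \<subseteq> {a..b} \<times> UNIV"
      using \<open>a < b\<close> by auto
    show ?thesis
      using continuous_on_compose2[OF H cont range] by (simp add: G_def case_prod_beta)
  qed
  obtain v Q where v: "\<And>x. x \<in> {a..b} \<Longrightarrow> (v has_real_derivative e x * Q x) (at x within {a..b})"
    and Q: "\<And>x. x \<in> {a..b} \<Longrightarrow> (Q has_real_derivative G x (v x) (Q x)) (at x within {a..b})"
    and bc: "v a = 0" "v b = 0"
    using bounded_bvp_solvable[OF e G_cont G_bd \<open>a < b\<close>] by metis
  have G_mono: "G x y q \<le> G x y' q" if "x \<in> {a..b}" "y \<le> y'" for x y y' q
    unfolding G_def using that by (intro mono) auto
  have G_lip: "\<bar>G x y q - G x y q'\<bar> \<le> K * \<bar>q - q'\<bar>" if "x \<in> {a..b}" for x y q q'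
  proof -
    have "\<bar>G x y q - G x y q'\<bar> \<le> K * \<bar>max (-Z) (min Z q) - max (-Z) (min Z q')\<bar>"
      unfolding G_def using that by (intro lip) auto
    also have "\<dots> \<le> K * \<bar>q - q'\<bar>"
      using \<open>K \<ge> 0\<close> by (intro mult_left_mono) auto
    finally show ?thesis .
  qed
  have G_00: "\<bar>G x 0 0\<bar> \<le> h0" if "x \<in> {a..b}" for x
    using h0[OF that] that \<open>M \<ge> 0\<close> \<open>Z \<ge> 0\<close> by (simp add: G_def)
  \<comment> \<open>Where \<open>v x > 0\<close>, one has \<open>G x (v x) (Q x) \<ge> G x 0 (Q x)
    \<ge> G x 0 0 - K * \<bar>Q x\<bar>\<close>, so \<open>comparison\<close> applies with
    \<open>\<rho> = h0\<close>. The lower bound is the same argument for \<open>- v\<close>.\<close>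
  have v_le: "v x \<le> M" if "x \<in> {a..b}" for x
    unfolding M_def
  proof (rule comparison[where d = v and R = Q and R' = "\<lambda>x. G x (v x) (Q x)" and e = e])
    show "- h0 - K * \<bar>Q x\<bar> \<le> G x (v x) (Q x)" if "x \<in> {a..b}" "0 < v x" for x
      using G_mono[OF that(1), of 0 "v x" "Q x"] G_lip[OF that(1), of 0 "Q x" 0] G_00[OF that(1)] that(2) by auto
  qed (use assms(1,2) e E' bc \<open>h0 \<ge> 0\<close> v Q that in auto)
  have v_ge: "- v x \<le> M" if "x \<in> {a..b}" for x
    unfolding M_def
  proof (rule comparison[where d = "\<lambda>x. - v x" and R = "\<lambda>x. - Q x" and R' = "\<lambda>x. - G x (v x) (Q x)" and e = e])
    show "- h0 - K * \<bar>- Q x\<bar> \<le> - G x (v x) (Q x)" if "x \<in> {a..b}" "0 < - v x" for x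
      using G_mono[OF that(1), of "v x" 0 "Q x"] G_lip[OF that(1), of 0 "Q x" 0] G_00[OF that(1)] that(2) by auto
    show "((\<lambda>x. - v x) has_real_derivative e x * - Q x) (at x within {a..b})" if "x \<in> {a..b}" for x
      using DERIV_minus[OF v[OF that]] by simp
  qed (use assms(1,2) e E' bc \<open>h0 \<ge> 0\<close> v Q that in \<open>auto intro: DERIV_minus\<close>)
  \<comment> \<open>The equal boundary values give an interior critical point of \<open>v\<close>,
    and there \<open>Q\<close> vanishes because \<open>e > 0\<close>. This is the starting point for
    the Gronwall bound on \<open>Q\<close>.\<close>
  obtain z where z: "a < z" "z < b" "(v has_real_derivative 0) (at z)"
  proof -
    have "\<exists>z>a. z < b \<and> (v has_real_derivative 0) (at z)"
    proof (rule Rolle[OF \<open>a < b\<close>])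
      show "continuous_on {a..b} v" by (rule DERIV_continuous_on) (rule v)
      show "v differentiable (at x)" if "a < x" "x < b" for x
        using v[of x] that at_within_Icc_at[of a x b] by (auto simp: real_differentiable_def)
    qed (use bc in auto)
    then show ?thesis using that by blast
  qed
  have "Q z = 0"
  proof -
    have "(v has_real_derivative e z * Q z) (at z)"
      using v[of z] z at_within_Icc_at[of a z b] by auto
    from DERIV_unique[OF this z(3)] show ?thesis using e(2)[of z] by simp
  qed
  have Q_bd: "\<bar>Q x\<bar> \<le> Z" if "x \<in> {a..b}" for x
    unfolding Z_def
  proof (rule gronwall_zero[OF \<open>K \<ge> 0\<close> \<open>h1 \<ge> 0\<close> Q _ _ \<open>Q z = 0\<close> that])
    show "\<bar>G x (v x) (Q x)\<bar> \<le> h1 + K * \<bar>Q x\<bar>" if x: "x \<in> {a..b}" for x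
    proof -
      have "\<bar>G x (v x) 0\<bar> \<le> h1"
        unfolding G_def using x \<open>M \<ge> 0\<close> \<open>Z \<ge> 0\<close> by (simp add: h1)
      then show ?thesis using G_lip[OF x, of "v x" "Q x" 0] by auto
    qed
  qed (use z in auto)
  have "G x (v x) (Q x) = H x (v x) (Q x)" if "x \<in> {a..b}" for x
  proof -
    have "max a (min b x) = x" "max (-M) (min M (v x)) = v x" "max (-Z) (min Z (Q x)) = Q x"
      using v_le[OF that] v_ge[OF that] Q_bd[OF that] that by auto
    then show ?thesis by (simp add: G_def)
  qed
  with Q have "(Q has_real_derivative H x (v x) (Q x)) (at x within {a..b})" if "x \<in> {a..b}" for x
    using that by metis
  with that v bc show ?thesis by blast
qed

subsection \<open>Schwartz functions and polynomial growth\<close>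

lemma DERIV_schwartz:
  assumes "schwartz \<Phi>"
  shows "((deriv ^^ k) \<Phi> has_real_derivative (deriv ^^ Suc k) \<Phi> x) (at x)"
  using assms by (auto simp: schwartz_def Ck_def DERIV_deriv_iff_real_differentiable dest: spec[of _ "Suc k"])

lemma funpow_deriv_eq:
  fixes D :: "nat \<Rightarrow> real \<Rightarrow> real"
  assumes "\<And>j x. (D j has_real_derivative D (Suc j) x) (at x)"
  shows "(deriv ^^ j) (D 0) = D j"
  by (induction j) (auto intro!: DERIV_imp_deriv assms)

text \<open>A family \<open>D\<close> of explicit successive derivatives is easier to estimate than
  the iterates of \<open>deriv\<close>, which are then identified with it.\<close>

lemma schwartzI:
  fixes D :: "nat \<Rightarrow> real \<Rightarrow> real"
  assumes D: "\<And>j x. (D j has_real_derivative D (Suc j) x) (at x)"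
    and bd: "\<And>i j. bounded (range (\<lambda>x. x ^ i * D j x))"
  shows "schwartz (D 0)"
proof -
  have eq: "(deriv ^^ j) (D 0) = D j" for j
    by (rule funpow_deriv_eq) (rule D)
  have "D j differentiable (at x)" "isCont (D j) x" for j x
    using D[of j x] by (auto simp: real_differentiable_def intro: DERIV_isCont)
  then show ?thesis
    using bd by (auto simp: schwartz_def Ck_def eq intro: continuous_at_imp_continuous_on)
qed

text \<open>Up to the sign \<open>(-1) ^ j\<close> these are the Hermite polynomials, the polynomial
  factors in the derivatives of \<open>exp (- x\<^sup>2)\<close>.\<close>

primrec gauss_poly :: "nat \<Rightarrow> real poly" where
  "gauss_poly 0 = 1"
| "gauss_poly (Suc j) = pderiv (gauss_poly j) - [:0, 2:] * gauss_poly j"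

definition gauss :: "nat \<Rightarrow> real \<Rightarrow> real" where
  "gauss j x = poly (gauss_poly j) x * exp (- x\<^sup>2)"

lemma DERIV_gauss: "(gauss j has_real_derivative gauss (Suc j) x) (at x)"
  unfolding gauss_def[abs_def] by (auto intro!: derivative_eq_intros simp: algebra_simps)

lemma power_le_fact_exp:
  fixes x :: real
  assumes "x \<ge> 0"
  shows "x ^ n \<le> fact n * exp x"
proof -
  have "(\<Sum>i\<in>{n}. x ^ i /\<^sub>R fact i) \<le> (\<Sum>i. x ^ i /\<^sub>R fact i)"
    by (rule sum_le_suminf) (use assms summable_exp_generic[of x] in auto)
  then have "x ^ n / fact n \<le> exp x"
    by (simp add: exp_def divide_inverse mult.commute)
  then show ?thesis
    by (simp add: field_simps)
qed

text \<open>Induction on the coefficients: the variable split off from the polynomial is absorbed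
  into the power, which is why \<open>i\<close> stays arbitrary.\<close>

lemma bounded_poly_gauss:
  fixes p :: "real poly"
  shows "\<exists>C. \<forall>x. \<bar>x ^ i * (poly p x * exp (- x\<^sup>2))\<bar> \<le> C"
proof (induction p arbitrary: i)
  case 0
  show ?case by auto
next
  case (pCons c p)
  obtain C where C: "\<And>x. \<bar>x ^ Suc i * (poly p x * exp (- x\<^sup>2))\<bar> \<le> C"
    using pCons(2)[of "Suc i"] by blast
  have base: "\<bar>x ^ i * exp (- x\<^sup>2)\<bar> \<le> 1 + fact i" for x :: real
  proof -
    \<comment> \<open>Squaring turns the power of \<open>\<bar>x\<bar>\<close> into one of
      \<open>x\<^sup>2\<close>, which a single term of the exponential series dominates.\<close>
    have "\<bar>x\<bar> ^ i \<le> 1 + (\<bar>x\<bar> ^ i)\<^sup>2"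
    proof -
      have "t \<le> 1 + t\<^sup>2" if "t \<ge> 0" for t :: real
        using zero_le_power2[of "t - 1"] that by (simp add: power2_diff)
      then show ?thesis by simp
    qed
    also have "(\<bar>x\<bar> ^ i)\<^sup>2 = (x\<^sup>2) ^ i"
      by (metis power2_abs power_mult mult.commute)
    also have "\<dots> \<le> fact i * exp (x\<^sup>2)"
      by (rule power_le_fact_exp) simp
    also have "1 \<le> exp (x\<^sup>2)" by simp
    finally have "\<bar>x\<bar> ^ i \<le> (1 + fact i) * exp (x\<^sup>2)" by (simp add: algebra_simps)
    then show ?thesis
      by (simp add: abs_mult power_abs exp_minus field_simps)
  qed
  have "\<bar>x ^ i * (poly (pCons c p) x * exp (- x\<^sup>2))\<bar> \<le> \<bar>c\<bar> * (1 + fact i) + C" for x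
  proof -
    have "x ^ i * (poly (pCons c p) x * exp (- x\<^sup>2)) = c * (x ^ i * exp (- x\<^sup>2)) + x ^ Suc i * (poly p x * exp (- x\<^sup>2))"
      by (simp add: algebra_simps)
    also have "\<bar>\<dots>\<bar> \<le> \<bar>c * (x ^ i * exp (- x\<^sup>2))\<bar> + \<bar>x ^ Suc i * (poly p x * exp (- x\<^sup>2))\<bar>"
      by (rule abs_triangle_ineq)
    also have "\<bar>c * (x ^ i * exp (- x\<^sup>2))\<bar> \<le> \<bar>c\<bar> * (1 + fact i)"
      using base[of x] unfolding abs_mult[of c] by (intro mult_left_mono) auto
    finally show ?thesis using C[of x] by simp
  qed
  then show ?case by blast
qed

lemma gauss_bounded:
  obtains C where "C \<ge> 0" "\<And>x. \<bar>x ^ i * gauss j x\<bar> \<le> C"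
proof -
  obtain C where "\<And>x. \<bar>x ^ i * gauss j x\<bar> \<le> C"
    using bounded_poly_gauss[of i "gauss_poly j"] unfolding gauss_def by blast
  moreover from this[of 0] have "C \<ge> 0" by linarith
  ultimately show ?thesis using that by blast
qed

text \<open>\<open>r\<close> will be a sequence of radii along which a given function grows faster than any polynomial.\<close>

lemma rapid_schwartz_ex:
  fixes r :: "nat \<Rightarrow> real"
  assumes r: "\<And>N. r N \<ge> 1"
  obtains \<Psi> where "schwartz \<Psi>" "\<And>x. \<Psi> x > 0"
    "\<And>N x. \<bar>x\<bar> \<le> r N \<Longrightarrow> \<Psi> x \<ge> exp (- 1) / (2 * r N) ^ N"
proof -
  \<comment> \<open>These weights beat every fixed power of the radii, since
    \<open>c N * r N ^ i \<le> (1 / 2) ^ N\<close> once \<open>N \<ge> i\<close>. Yet each is only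
    an inverse power of \<open>2 * r N\<close>, so growth faster than every power along
    \<open>r\<close> still wins against them.\<close>
  define c where "c N = 1 / (2 * r N) ^ N" for N
  have c: "c N > 0" "c N \<le> (1 / 2) ^ N" for N
    using r[of N] by (auto simp: c_def power_mult_distrib field_simps one_le_power)
  \<comment> \<open>\<open>F j N\<close> is the \<open>j\<close>-th derivative of the Gaussian of
    width \<open>r N\<close> and height \<open>c N\<close>.\<close>
  define F where "F j N x = c N / r N ^ j * gauss j (x / r N)" for j N x
  define D where "D j x = (\<Sum>N. F j N x)" for j x
  have F_pow: "\<exists>C. \<forall>N x. \<bar>x ^ i * F j N x\<bar> \<le> C * (c N * r N ^ i)" for i j
  proof -
    obtain C where C: "C \<ge> 0" "\<And>x. \<bar>x ^ i * gauss j x\<bar> \<le> C"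
      using gauss_bounded by blast
    have "\<bar>x ^ i * F j N x\<bar> \<le> C * (c N * r N ^ i)" for N x
    proof -
      have rN: "r N > 0" using r[of N] by linarith
      have "x ^ i * F j N x = (c N * r N ^ i / r N ^ j) * ((x / r N) ^ i * gauss j (x / r N))"
        using rN by (simp add: F_def field_simps)
      also have "\<bar>\<dots>\<bar> = (c N * r N ^ i / r N ^ j) * \<bar>(x / r N) ^ i * gauss j (x / r N)\<bar>"
        unfolding abs_mult[of "c N * r N ^ i / r N ^ j"] using rN c(1)[of N] by simp
      also have "\<dots> \<le> (c N * r N ^ i / r N ^ j) * C"
        using rN c(1)[of N] by (intro mult_left_mono C) auto
      also have "\<dots> \<le> (c N * r N ^ i) * C"
        using rN c(1)[of N] C(1) r[of N] one_le_power[OF r[of N], of j]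
        by (intro mult_right_mono) (auto simp: field_simps)
      finally show ?thesis by (simp add: mult_ac)
    qed
    then show ?thesis by blast
  qed
  have c_sum: "summable (\<lambda>N. c N * r N ^ i)" for i
  proof (rule summable_comparison_test'[where g = "\<lambda>N. (1 / 2) ^ N" and N = i])
    show "summable (\<lambda>N. (1 / 2 :: real) ^ N)" by (rule summable_geometric) simp
    show "norm (c N * r N ^ i) \<le> (1 / 2) ^ N" if "i \<le> N" for N
    proof -
      have "r N ^ i \<le> r N ^ N" using that r[of N] by (rule power_increasing)
      then have "c N * r N ^ i \<le> c N * r N ^ N" using c(1)[of N] by simp
      also have "\<dots> = (1 / 2) ^ N" using r[of N] by (simp add: c_def power_mult_distrib field_simps)
      finally show ?thesis using c(1)[of N] r[of N] by simp
    qed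
  qed
  have F_bd: "\<exists>C. \<forall>N x. \<bar>F j N x\<bar> \<le> C * c N" for j
    using F_pow[of 0 j] by simp
  have F_sum: "summable (\<lambda>N. F j N x)" for j x
  proof -
    obtain C where C: "\<And>N x. \<bar>F j N x\<bar> \<le> C * c N"
      using F_bd[of j] by blast
    show ?thesis
      by (rule summable_comparison_test'[where g = "\<lambda>N. C * c N"]) (use C c_sum[of 0] in \<open>auto intro: summable_mult\<close>)
  qed
  have DERIV_D: "(D j has_real_derivative D (Suc j) x) (at x)" for j x
    unfolding D_def[abs_def]
  proof (rule has_field_derivative_series'(2)[where S = UNIV and ?x0.0 = 0])
    show "(F j N has_real_derivative F (Suc j) N x) (at x within UNIV)" for N x
      unfolding F_def[abs_def] using r[of N]
      by (auto intro!: derivative_eq_intros DERIV_chain2[OF DERIV_gauss] simp: field_simps)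
    obtain C where C: "\<And>N x. \<bar>F (Suc j) N x\<bar> \<le> C * c N"
      using F_bd[of "Suc j"] by blast
    show "uniformly_convergent_on UNIV (\<lambda>n x. \<Sum>i<n. F (Suc j) i x)"
      by (rule Weierstrass_m_test'_ev[where M = "\<lambda>N. C * c N"])
        (use C c_sum[of 0] in \<open>auto intro: summable_mult\<close>)
  qed (use F_sum in auto)
  have D_bd: "bounded (range (\<lambda>x. x ^ i * D j x))" for i j
  proof -
    obtain C where C: "\<And>N x. \<bar>x ^ i * F j N x\<bar> \<le> C * (c N * r N ^ i)"
      using F_pow[of i j] by blast
    have sum: "summable (\<lambda>N. C * (c N * r N ^ i))" by (intro summable_mult c_sum)
    have "norm (x ^ i * D j x) \<le> (\<Sum>N. C * (c N * r N ^ i))" for x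
    proof -
      have "x ^ i * D j x = (\<Sum>N. x ^ i * F j N x)"
        unfolding D_def by (rule suminf_mult[symmetric, OF F_sum])
      then show ?thesis
        using norm_suminf_le[OF _ sum, of "\<lambda>N. x ^ i * F j N x"] C by simp
    qed
    then show ?thesis by (auto simp: bounded_iff)
  qed
  have F0: "F 0 N x = c N * exp (- (x / r N)\<^sup>2)" for N x
    by (simp add: F_def gauss_def)
  have ge: "D 0 x \<ge> F 0 N x" for N x
    unfolding D_def
    using sum_le_suminf[OF F_sum[of 0 x], of "{N}"] c(1) by (auto simp: F0 less_imp_le)
  show ?thesis
  proof (rule that[of "D 0"])
    show "schwartz (D 0)" by (rule schwartzI) (use DERIV_D D_bd in auto)
    show "D 0 x > 0" for x
      using ge[of 0 x] c(1)[of 0] by (auto simp: F0 intro: less_le_trans[rotated])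
    \<comment> \<open>All summands are positive, so the \<open>N\<close>-th one alone gives the
      bound; within its width it has dropped by at most the factor \<open>exp (- 1)\<close>.\<close>
    show "D 0 x \<ge> exp (- 1) / (2 * r N) ^ N" if "\<bar>x\<bar> \<le> r N" for x N
    proof -
      have "\<bar>x / r N\<bar> \<le> 1" using that r[of N] by (simp add: field_simps)
      then have "(x / r N)\<^sup>2 \<le> 1" by (simp add: abs_square_le_1)
      then have "exp (- 1) \<le> exp (- (x / r N)\<^sup>2)" by (simp only: exp_le_cancel_iff)
      then have "c N * exp (- 1) \<le> F 0 N x"
        unfolding F0 using c(1)[of N] by (intro mult_left_mono) auto
      with ge[of N x] show ?thesis by (simp add: c_def)
    qed
  qed
qed

section \<open>Decay of Schwartz functions and polynomial growth in the mean\<close>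

lemma schwartz_decay:
  assumes "schwartz \<Phi>"
  obtains C where "C \<ge> 0" "\<And>x. \<bar>\<Phi> x\<bar> \<le> C / (1 + \<bar>x\<bar>) ^ N"
proof -
  have bdd: "\<exists>C. \<forall>x. \<bar>x ^ j * \<Phi> x\<bar> \<le> C" for j
  proof -
    have "bounded (range (\<lambda>x. x ^ j * (deriv ^^ 0) \<Phi> x))"
      using assms unfolding schwartz_def by blast
    then show ?thesis by (auto simp: bounded_iff)
  qed
  obtain C0 CN where C0: "\<And>x. \<bar>\<Phi> x\<bar> \<le> C0" and CN: "\<And>x. \<bar>x ^ N * \<Phi> x\<bar> \<le> CN"
    using bdd[of 0] bdd[of N] by auto
  have bd: "(1 + \<bar>x\<bar>) ^ N * \<bar>\<Phi> x\<bar> \<le> 2 ^ N * (C0 + CN)" for x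
  proof -
    have "(1 + \<bar>x\<bar>) ^ N \<le> (2 * max 1 \<bar>x\<bar>) ^ N" by (intro power_mono) auto
    also have "\<dots> \<le> 2 ^ N * (1 + \<bar>x\<bar> ^ N)"
      unfolding power_mult_distrib by (intro mult_left_mono) (auto simp: max_def)
    finally have "(1 + \<bar>x\<bar>) ^ N * \<bar>\<Phi> x\<bar> \<le> 2 ^ N * (1 + \<bar>x\<bar> ^ N) * \<bar>\<Phi> x\<bar>"
      by (intro mult_right_mono) auto
    also have "\<dots> = 2 ^ N * (\<bar>\<Phi> x\<bar> + \<bar>x ^ N * \<Phi> x\<bar>)"
      by (simp add: algebra_simps abs_mult power_abs)
    also have "\<dots> \<le> 2 ^ N * (C0 + CN)"
      using C0[of x] CN[of x] by (intro mult_left_mono) auto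
    finally show ?thesis .
  qed
  have "0 < (1 + \<bar>x\<bar>) ^ N" for x :: real by simp
  then have "\<bar>\<Phi> x\<bar> \<le> 2 ^ N * (C0 + CN) / (1 + \<bar>x\<bar>) ^ N" for x
    using bd[of x] by (simp add: pos_le_divide_eq mult.commute)
  moreover have "2 ^ N * (C0 + CN) \<ge> 0"
    using bd[of 0] by (auto intro: order_trans[rotated])
  ultimately show ?thesis using that by blast
qed

lemma schwartz_deriv:
  assumes "schwartz \<Phi>"
  shows "schwartz (deriv \<Phi>)"
proof -
  have "bounded (range (\<lambda>x. x ^ i * (deriv ^^ Suc j) \<Phi> x))" for i j
    using assms unfolding schwartz_def by blast
  from schwartzI[of "\<lambda>j. (deriv ^^ Suc j) \<Phi>", OF DERIV_schwartz[OF assms] this]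
  show ?thesis by simp
qed

lemma schwartz_dilate:
  assumes \<Phi>: "schwartz \<Phi>"
  shows "schwartz (dilate \<Phi> n)"
proof -
  define D where "D j x = real n ^ Suc j * (deriv ^^ j) \<Phi> (real n * x)" for j x
  have "schwartz (D 0)"
  proof (rule schwartzI)
    show "(D j has_real_derivative D (Suc j) x) (at x)" for j x
      unfolding D_def[abs_def]
      by (auto intro!: derivative_eq_intros DERIV_chain2[OF DERIV_schwartz[OF \<Phi>]] simp del: funpow.simps)
    show "bounded (range (\<lambda>x. x ^ i * D j x))" for i j
    proof -
      have "bounded (range (\<lambda>x. x ^ i * (deriv ^^ j) \<Phi> x))"
        using \<Phi> unfolding schwartz_def by blast
      then obtain C where C: "\<And>x. \<bar>x ^ i * (deriv ^^ j) \<Phi> x\<bar> \<le> C" by (auto simp: bounded_iff)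
      have "norm (x ^ i * D j x) \<le> real n ^ Suc j * C" for x
      \<comment> \<open>For \<open>n = 0\<close> the dilation is the zero function; for
        \<open>n \<ge> 1\<close> the factor \<open>real n ^ i \<ge> 1\<close> may be inserted to
        reach the argument \<open>real n * x\<close>.\<close>
      proof (cases "n = 0")
        case True
        then show ?thesis by (simp add: D_def)
      next
        case False
        have n: "real n ^ i \<ge> 1" "real n > 0" using False by auto
        have "\<bar>x ^ i * (deriv ^^ j) \<Phi> (real n * x)\<bar> \<le> real n ^ i * \<bar>x ^ i * (deriv ^^ j) \<Phi> (real n * x)\<bar>"
          using n(1) by (simp add: mult_le_cancel_right1)
        also have "\<dots> = \<bar>(real n * x) ^ i * (deriv ^^ j) \<Phi> (real n * x)\<bar>"
          by (simp add: abs_mult power_mult_distrib)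
        also have "\<dots> \<le> C" by (rule C)
        finally have "real n ^ Suc j * \<bar>x ^ i * (deriv ^^ j) \<Phi> (real n * x)\<bar> \<le> real n ^ Suc j * C"
          by (intro mult_left_mono) auto
        then show ?thesis by (simp add: D_def abs_mult mult_ac)
      qed
      then show ?thesis by (auto simp: bounded_iff)
    qed
  qed
  moreover have "D 0 = dilate \<Phi> n" by (auto simp: D_def dilate_def)
  ultimately show ?thesis by simp
qed

text \<open>The line is cut into the shells where \<open>\<bar>y\<bar>\<close> has integer part
  \<open>n\<close>. On such a shell the weight is at most \<open>1 / real (Suc n) ^ (N + 2)\<close>,
  so its contribution is at most \<open>C / real (Suc n) ^ 2\<close>; the two extra powers make the
  series converge.\<close>

lemma poly_growth_integrable:
  fixes g :: "real \<Rightarrow> real"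
  assumes g: "continuous_on UNIV g"
    and J: "\<And>R::nat. R \<ge> 1 \<Longrightarrow> (LINT y|lborel. indicator {-real R..real R} y * \<bar>g y\<bar>) \<le> C * real R ^ N"
  shows "integrable lborel (\<lambda>y. g y / (1 + \<bar>y\<bar>) ^ (N + 2))"
proof -
  define f where "f n y = (if nat \<lfloor>\<bar>y\<bar>\<rfloor> = n then g y / (1 + \<bar>y\<bar>) ^ (N + 2) else 0)" for n y
  have [measurable]: "g \<in> borel_measurable borel" using g by (rule borel_measurable_continuous_onI)
  have int: "integrable lborel (\<lambda>y. indicator {-r..r} y * \<bar>g y\<bar>)" for r :: real
    using borel_integrable_compact[of "{-r..r}" "\<lambda>y. \<bar>g y\<bar>"] continuous_on_subset[OF g]
    by (auto intro!: continuous_intros)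
  have f_meas [measurable]: "f n \<in> borel_measurable lborel" for n
    unfolding f_def by measurable
  have f_le: "norm (f n y) \<le> indicator {-real (Suc n)..real (Suc n)} y * \<bar>g y\<bar> / real (Suc n) ^ (N + 2)" for n y
  proof (cases "nat \<lfloor>\<bar>y\<bar>\<rfloor> = n")
    case True
    then have y: "real n \<le> \<bar>y\<bar>" "\<bar>y\<bar> \<le> real (Suc n)" by linarith+
    have "\<bar>g y\<bar> / (1 + \<bar>y\<bar>) ^ (N + 2) \<le> \<bar>g y\<bar> / real (Suc n) ^ (N + 2)"
      using y by (intro divide_left_mono power_mono mult_pos_pos zero_less_power) auto
    moreover have "y \<in> {-real (Suc n)..real (Suc n)}" using y by auto
    ultimately show ?thesis using True by (simp add: f_def)
  qed (simp add: f_def)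
  have f_int: "integrable lborel (f n)" for n
    by (rule Bochner_Integration.integrable_bound[OF integrable_divide[OF int[of "real (Suc n)"], of "real (Suc n) ^ (N + 2)"]])
      (use f_le f_meas in \<open>auto intro!: AE_I2 order_trans[OF f_le]\<close>)
  have "integrable lborel (\<lambda>y. \<Sum>n. f n y)"
  proof (rule integrable_suminf[OF f_int])
    show "AE y in lborel. summable (\<lambda>n. norm (f n y))"
    proof (rule AE_I2)
      fix y
      show "summable (\<lambda>n. norm (f n y))"
        by (rule summable_finite[of "{nat \<lfloor>\<bar>y\<bar>\<rfloor>}"]) (auto simp: f_def)
    qed
    show "summable (\<lambda>n. LINT y|lborel. norm (f n y))"
    proof (rule summable_comparison_test')
      show "summable (\<lambda>n. C * inverse (real (Suc n) ^ 2))"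
        using inverse_power_summable[of 2, where 'a = real] summable_Suc_iff[of "\<lambda>n. inverse (real n ^ 2)"]
        by (intro summable_mult) blast
      fix n :: nat
      have "(LINT y|lborel. norm (f n y)) \<le> (LINT y|lborel. indicator {-real (Suc n)..real (Suc n)} y * \<bar>g y\<bar> / real (Suc n) ^ (N + 2))"
        by (intro integral_mono integrable_divide int integrable_norm f_int f_le)
      also have "\<dots> = (LINT y|lborel. indicator {-real (Suc n)..real (Suc n)} y * \<bar>g y\<bar>) / real (Suc n) ^ (N + 2)"
        by simp
      also have "\<dots> \<le> C * real (Suc n) ^ N / real (Suc n) ^ (N + 2)"
        by (intro divide_right_mono J) auto
      also have "\<dots> = C * inverse (real (Suc n) ^ 2)"
        by (simp add: power_add field_simps power2_eq_square del: of_nat_Suc)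
      finally show "norm (LINT y|lborel. norm (f n y)) \<le> C * inverse (real (Suc n) ^ 2)"
        by simp
    qed
  qed
  moreover have "(\<Sum>n. f n y) = g y / (1 + \<bar>y\<bar>) ^ (N + 2)" for y
    unfolding f_def
    by (subst suminf_finite[of "{nat \<lfloor>\<bar>y\<bar>\<rfloor>}"]) auto
  ultimately show ?thesis by simp
qed

lemma integrable_weight: "integrable lborel (\<lambda>y::real. 1 / (1 + \<bar>y\<bar>) ^ 3)"
proof -
  have "integrable lborel (\<lambda>y::real. 1 / (1 + \<bar>y\<bar>) ^ (1 + 2))"
    by (rule poly_growth_integrable[where C = 2]) auto
  moreover have "(1 + 2 :: nat) = 3" by simp
  ultimately show ?thesis by (simp only:)
qed

text \<open>Growth is measured in the mean: integrability against mollifiers gives no pointwise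
  bound, as a continuous function may have high, narrow spikes.\<close>

definition tempered :: "nat \<Rightarrow> (real \<Rightarrow> real) \<Rightarrow> bool" where
  "tempered N g \<longleftrightarrow> continuous_on UNIV g \<and> integrable lborel (\<lambda>y. g y / (1 + \<bar>y\<bar>) ^ N)"

lemma tempered_mono:
  assumes "tempered N g" "N \<le> M"
  shows "tempered M g"
proof -
  have [measurable]: "g \<in> borel_measurable borel"
    using assms by (auto simp: tempered_def intro: borel_measurable_continuous_onI)
  have "integrable lborel (\<lambda>y. g y / (1 + \<bar>y\<bar>) ^ M)"
  proof (rule Bochner_Integration.integrable_bound)
    show "integrable lborel (\<lambda>y. g y / (1 + \<bar>y\<bar>) ^ N)" using assms by (simp add: tempered_def)
    have "\<bar>g y\<bar> / (1 + \<bar>y\<bar>) ^ M \<le> \<bar>g y\<bar> / (1 + \<bar>y\<bar>) ^ N" for y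
      using assms by (intro divide_left_mono power_increasing mult_pos_pos zero_less_power) auto
    then show "AE y in lborel. norm (g y / (1 + \<bar>y\<bar>) ^ M) \<le> norm (g y / (1 + \<bar>y\<bar>) ^ N)"
      by simp
  qed measurable
  then show ?thesis using assms by (simp add: tempered_def)
qed

lemma schwartz_integrable:
  assumes "schwartz \<Phi>"
  shows "integrable lborel \<Phi>"
proof -
  obtain C where "C \<ge> 0" and C: "\<And>x. \<bar>\<Phi> x\<bar> \<le> C / (1 + \<bar>x\<bar>) ^ 3"
    using schwartz_decay[OF assms, of 3] by blast
  have "continuous_on UNIV \<Phi>"
    using DERIV_schwartz[OF assms, of 0] by (auto intro: DERIV_isCont continuous_at_imp_continuous_on)
  then have [measurable]: "\<Phi> \<in> borel_measurable borel" by (rule borel_measurable_continuous_onI)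
  show ?thesis
    by (rule Bochner_Integration.integrable_bound[OF integrable_mult_right[OF integrable_weight, of C]])
      (use C \<open>C \<ge> 0\<close> in auto)
qed

lemma mollifier_normalize:
  assumes \<Psi>: "schwartz \<Psi>" and pos: "\<And>x. \<Psi> x > 0"
  obtains c where "c > 0" "mollifier (\<lambda>x. c * \<Psi> x)"
proof -
  have int: "integrable lborel \<Psi>" by (rule schwartz_integrable) fact
  have "(LINT x|lborel. \<Psi> x) \<noteq> 0"
  proof
    assume "(LINT x|lborel. \<Psi> x) = 0"
    then have "AE x in lborel. \<Psi> x = 0"
      using integral_nonneg_eq_0_iff_AE[OF int] pos by (auto simp: less_imp_le)
    moreover have "\<Psi> x \<noteq> 0" for x
      using pos[of x] by simp
    ultimately show False
      by (simp add: AE_iff_measurable[OF _ refl])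
  qed
  moreover have "(LINT x|lborel. \<Psi> x) \<ge> 0" using pos by (intro integral_nonneg_AE) (auto simp: less_imp_le)
  ultimately have I: "(LINT x|lborel. \<Psi> x) > 0" by linarith
  define c where "c = 1 / (LINT x|lborel. \<Psi> x)"
  have "schwartz (\<lambda>x. c * (deriv ^^ 0) \<Psi> x)"
  proof (rule schwartzI)
    show "((\<lambda>x. c * (deriv ^^ j) \<Psi> x) has_real_derivative c * (deriv ^^ Suc j) \<Psi> x) (at x)" for j x
      by (intro DERIV_cmult DERIV_schwartz \<Psi>)
    show "bounded (range (\<lambda>x. x ^ i * (c * (deriv ^^ j) \<Psi> x)))" for i j
    proof -
      have "bounded ((\<lambda>x. c * x) ` range (\<lambda>x. x ^ i * (deriv ^^ j) \<Psi> x))"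
        by (rule bounded_linear_image[OF _ bounded_linear_mult_right]) (use \<Psi> in \<open>unfold schwartz_def, blast\<close>)
      then show ?thesis by (simp add: image_image mult_ac)
    qed
  qed
  moreover have "(LINT x|lborel. c * \<Psi> x) = 1" using I by (simp add: c_def)
  ultimately have "mollifier (\<lambda>x. c * \<Psi> x)" by (simp add: mollifier_def)
  moreover have "c > 0" using I by (simp add: c_def)
  ultimately show ?thesis using that by blast
qed

text \<open>\<open>C1_solution\<close> quantifies over all mollifiers, so information is drawn from
  it only with a mollifier at hand.\<close>

lemma mollifier_ex: "\<exists>\<Phi>. mollifier \<Phi>"
proof -
  obtain \<Psi> where "schwartz \<Psi>" "\<And>x. \<Psi> x > 0"
    by (rule rapid_schwartz_ex[of "\<lambda>_. 1"]) auto
  from mollifier_normalize[OF this] show ?thesis by metis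
qed

lemma schwartz_dual_poly_growth:
  fixes g :: "real \<Rightarrow> real"
  assumes g: "continuous_on UNIV g"
    and int: "\<And>\<Phi>. mollifier \<Phi> \<Longrightarrow> integrable lborel (\<lambda>y. g y * \<Phi> y)"
  shows "\<exists>C N. \<forall>R::nat. R \<ge> 1 \<longrightarrow> (LINT y|lborel. indicator {-real R..real R} y * \<bar>g y\<bar>) \<le> C * real R ^ N"
proof (rule ccontr)
  let ?J = "\<lambda>R. LINT y|lborel. indicator {-real R..real R} y * \<bar>g y\<bar>"
  assume "\<not> ?thesis"
  \<comment> \<open>The failed bound is taken with exponent \<open>N\<close> and constant
    \<open>real N * 2 ^ N\<close>. The power of \<open>2 * r N\<close> in the lower bound for
    \<open>\<Psi>\<close> then cancels, and the integral of
    \<open>\<bar>g y\<bar> * \<Psi> y\<close> exceeds \<open>real N * exp (- 1)\<close> for every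
    \<open>N\<close>.\<close>
  then have "\<exists>R\<ge>1. ?J R > (real N * 2 ^ N) * real R ^ N" for N
    by (metis not_le)
  then obtain r where r: "\<And>N::nat. r N \<ge> (1::nat)" "\<And>N. ?J (r N) > (real N * 2 ^ N) * real (r N) ^ N"
    by metis
  obtain \<Psi> where \<Psi>: "schwartz \<Psi>" "\<And>x. \<Psi> x > 0"
    "\<And>N x. \<bar>x\<bar> \<le> real (r N) \<Longrightarrow> \<Psi> x \<ge> exp (- 1) / (2 * real (r N)) ^ N"
    using rapid_schwartz_ex[of "\<lambda>N. real (r N)"] r(1) by auto
  obtain c where c: "c > 0" "mollifier (\<lambda>x. c * \<Psi> x)"
    using mollifier_normalize[OF \<Psi>(1,2)] by blast
  have "integrable lborel (\<lambda>y. inverse c * (g y * (c * \<Psi> y)))"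
    by (intro integrable_mult_right int c)
  then have "integrable lborel (\<lambda>y. g y * \<Psi> y)" using c by (simp add: field_simps)
  from integrable_abs[OF this] have int': "integrable lborel (\<lambda>y. \<bar>g y\<bar> * \<Psi> y)"
    using \<Psi>(2) by (simp add: abs_mult less_imp_le)
  have "real N * exp (- 1) \<le> (LINT y|lborel. \<bar>g y\<bar> * \<Psi> y)" for N
  proof -
    let ?q = "exp (- 1) / (2 * real (r N)) ^ N"
    have q: "?q > 0" using r(1)[of N] by simp
    have "real N * exp (- 1) = ?q * ((real N * 2 ^ N) * real (r N) ^ N)"
      using r(1)[of N] by (simp add: power_mult_distrib)
    also have "\<dots> \<le> ?q * ?J (r N)"
      using r(2)[of N] q by (intro mult_left_mono) auto
    also have "\<dots> = (LINT y|lborel. ?q * (indicator {-real (r N)..real (r N)} y * \<bar>g y\<bar>))" by simp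
    also have "\<dots> \<le> (LINT y|lborel. \<bar>g y\<bar> * \<Psi> y)"
    proof (rule integral_mono)
      show "integrable lborel (\<lambda>y. ?q * (indicator {-real (r N)..real (r N)} y * \<bar>g y\<bar>))"
        using borel_integrable_compact[of "{-real (r N)..real (r N)}" "\<lambda>y. \<bar>g y\<bar>"] continuous_on_subset[OF g]
        by (intro integrable_mult_right) (auto intro!: continuous_intros)
      show "?q * (indicator {-real (r N)..real (r N)} y * \<bar>g y\<bar>) \<le> \<bar>g y\<bar> * \<Psi> y" for y
      proof (cases "y \<in> {-real (r N)..real (r N)}")
        case True
        then show ?thesis using mult_right_mono[OF \<Psi>(3)[of y N], of "\<bar>g y\<bar>"] by (simp add: mult.commute abs_le_iff)
      qed (use \<Psi>(2)[of y] in simp)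
    qed (rule int')
    finally show ?thesis .
  qed
  moreover obtain N :: nat where "(LINT y|lborel. \<bar>g y\<bar> * \<Psi> y) / exp (- 1) < real N"
    using reals_Archimedean2 by blast
  then have "(LINT y|lborel. \<bar>g y\<bar> * \<Psi> y) < real N * exp (- 1)"
    by (simp add: pos_divide_less_eq)
  ultimately show False by (meson not_less)
qed

text \<open>The convolution at the point \<open>0\<close> with \<open>n = 1\<close> tests the
  reflected function against every mollifier; the weight is even, so the reflection can be
  undone.\<close>

lemma convolvable_imp_tempered:
  assumes g: "continuous_on UNIV g" and conv: "\<And>\<Phi>. mollifier \<Phi> \<Longrightarrow> convolvable g (dilate \<Phi> 1)"
  shows "\<exists>N. tempered N g"
proof -
  have g': "continuous_on UNIV (\<lambda>y. g (- y))"
    by (rule continuous_on_compose2[OF g]) (auto intro: continuous_intros)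
  have int: "integrable lborel (\<lambda>y. g (- y) * \<Phi> y)" if "mollifier \<Phi>" for \<Phi>
    using conv[OF that] by (auto simp: convolvable_def dilate_def dest: spec[of _ 0])
  obtain C N where "\<And>R::nat. R \<ge> 1 \<Longrightarrow> (LINT y|lborel. indicator {-real R..real R} y * \<bar>g (- y)\<bar>) \<le> C * real R ^ N"
    using schwartz_dual_poly_growth[OF g' int] by blast
  from poly_growth_integrable[OF g' this] have "integrable lborel (\<lambda>y. g (- y) / (1 + \<bar>y\<bar>) ^ (N + 2))" .
  from lborel_integrable_real_affine[OF this, of "- 1" 0]
  have "tempered (N + 2) g" using g by (simp add: tempered_def)
  then show ?thesis by blast
qed

subsection \<open>Mollification\<close>

text \<open>A form of Peetre's inequality, from \<open>1 + \<bar>y\<bar> \<le> (1 + \<bar>x\<bar>) *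
  (1 + \<bar>x - y\<bar>)\<close>. It makes decay estimates uniform under bounded
  translations.\<close>

lemma inverse_weight_shift:
  fixes x y :: real
  shows "1 / (1 + \<bar>x - y\<bar>) ^ N \<le> (1 + \<bar>x\<bar>) ^ N / (1 + \<bar>y\<bar>) ^ N"
proof -
  have "1 + \<bar>y\<bar> \<le> 1 + \<bar>x - y\<bar> + \<bar>x\<bar>" by simp
  also have "\<dots> \<le> (1 + \<bar>x\<bar>) * (1 + \<bar>x - y\<bar>)" by (simp add: algebra_simps)
  finally have "(1 + \<bar>y\<bar>) ^ N \<le> ((1 + \<bar>x\<bar>) * (1 + \<bar>x - y\<bar>)) ^ N"
    by (rule power_mono) simp
  then show ?thesis
    unfolding power_mult_distrib by (simp add: pos_divide_le_eq pos_le_divide_eq)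
qed

lemma schwartz_continuous:
  assumes "schwartz \<Phi>" shows "continuous_on S \<Phi>"
  using DERIV_schwartz[OF assms, of 0] by (auto intro: DERIV_isCont continuous_at_imp_continuous_on)

text \<open>Puts \<open>x\<close> into the smooth factor, so that differentiation falls on
  \<open>\<phi>\<close> and not on the merely continuous \<open>g\<close>.\<close>

lemma convol_flip: "convol g \<phi> x = (LINT y|lborel. g y * \<phi> (x - y))"
  using lborel_integral_real_affine[of "- 1" "\<lambda>y. g y * \<phi> (x - y)" x]
  by (simp add: convol_def)

lemma tempered_abs_integrable:
  assumes "tempered N g"
  shows "integrable lborel (\<lambda>y. \<bar>g y\<bar> / (1 + \<bar>y\<bar>) ^ N)"
  using assms integrable_abs[of lborel "\<lambda>y. g y / (1 + \<bar>y\<bar>) ^ N"] by (simp add: tempered_def)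

lemma tempered_shift_integrable:
  assumes g: "tempered N g" and \<phi>: "continuous_on UNIV \<phi>" and C: "\<And>y. \<bar>\<phi> y\<bar> \<le> C / (1 + \<bar>x - y\<bar>) ^ N"
  shows "integrable lborel (\<lambda>y. g y * \<phi> y)"
proof -
  have [measurable]: "g \<in> borel_measurable borel" "\<phi> \<in> borel_measurable borel"
    using g \<phi> by (auto simp: tempered_def intro: borel_measurable_continuous_onI)
  have "C \<ge> 0" using C[of x] by simp
  show ?thesis
  proof (rule Bochner_Integration.integrable_bound)
    show "integrable lborel (\<lambda>y. C * (1 + \<bar>x\<bar>) ^ N * (\<bar>g y\<bar> / (1 + \<bar>y\<bar>) ^ N))"
      by (intro integrable_mult_right tempered_abs_integrable g)
    show "AE y in lborel. norm (g y * \<phi> y) \<le> norm (C * (1 + \<bar>x\<bar>) ^ N * (\<bar>g y\<bar> / (1 + \<bar>y\<bar>) ^ N))"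
    proof (rule AE_I2)
      fix y
      have "\<bar>\<phi> y\<bar> \<le> C * ((1 + \<bar>x\<bar>) ^ N / (1 + \<bar>y\<bar>) ^ N)"
        using mult_left_mono[OF inverse_weight_shift[of x y N] \<open>C \<ge> 0\<close>] C[of y] by simp
      then have "\<bar>g y\<bar> * \<bar>\<phi> y\<bar> \<le> \<bar>g y\<bar> * (C * ((1 + \<bar>x\<bar>) ^ N / (1 + \<bar>y\<bar>) ^ N))"
        by (rule mult_left_mono) simp
      then show "norm (g y * \<phi> y) \<le> norm (C * (1 + \<bar>x\<bar>) ^ N * (\<bar>g y\<bar> / (1 + \<bar>y\<bar>) ^ N))"
        using \<open>C \<ge> 0\<close> by (simp add: abs_mult mult_ac)
    qed
  qed measurable
qed

lemma convol_integrable: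
  assumes g: "tempered N g" and \<phi>: "schwartz \<phi>"
  shows "integrable lborel (\<lambda>y. g y * \<phi> (x - y))"
proof -
  obtain C where C: "\<And>x. \<bar>\<phi> x\<bar> \<le> C / (1 + \<bar>x\<bar>) ^ N"
    using schwartz_decay[OF \<phi>, of N] by blast
  show ?thesis
    by (rule tempered_shift_integrable[OF g])
      (use C in \<open>auto intro!: continuous_on_compose2[OF schwartz_continuous[OF \<phi>, of UNIV]] continuous_intros\<close>)
qed

lemma DERIV_convol:
  assumes g: "tempered N g" and \<phi>: "schwartz \<phi>"
  shows "(convol g \<phi> has_real_derivative convol g (deriv \<phi>) x) (at x)"
  unfolding has_field_derivative_iff tendsto_at_iff_sequentially
proof (intro allI impI)
  fix X :: "nat \<Rightarrow> real"
  assume "\<forall>i. X i \<in> UNIV - {x}" and X: "X \<longlonglongrightarrow> x"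
  then have ne: "X i \<noteq> x" for i by blast
  have d\<phi>: "(\<phi> has_real_derivative deriv \<phi> y) (at y)" for y
    using DERIV_schwartz[OF \<phi>, of 0] by simp
  have d\<phi>_shift: "((\<lambda>z. \<phi> (z - y)) has_real_derivative deriv \<phi> (z - y)) (at z)" for y z
    by (rule DERIV_chain2[where f = \<phi> and g = "\<lambda>z. z - y", THEN DERIV_cong, OF d\<phi>])
      (auto intro!: derivative_eq_intros)
  have [measurable]: "g \<in> borel_measurable borel" "\<phi> \<in> borel_measurable borel" "deriv \<phi> \<in> borel_measurable borel"
    using g schwartz_continuous[OF \<phi>] schwartz_continuous[OF schwartz_deriv[OF \<phi>]]
    by (auto simp: tempered_def intro: borel_measurable_continuous_onI)
  obtain B where B: "\<And>i. \<bar>X i\<bar> \<le> B"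
    using convergent_imp_Bseq[OF convergentI[OF X]] by (auto simp: Bseq_def)
  have "\<bar>x\<bar> \<le> B"
    by (rule LIMSEQ_le_const2[OF tendsto_rabs[OF X]]) (use B in auto)
  obtain C where "C \<ge> 0" and C: "\<And>x. \<bar>deriv \<phi> x\<bar> \<le> C / (1 + \<bar>x\<bar>) ^ N"
    using schwartz_decay[OF schwartz_deriv[OF \<phi>], of N] by blast
  \<comment> \<open>By the mean value theorem the quotient is
    \<open>deriv \<phi> (\<xi> - y)\<close> with \<open>\<bar>\<xi>\<bar> \<le> B\<close>; the
    weight inequality gives a majorant that is independent of \<open>i\<close>.\<close>
  have bd: "\<bar>(\<phi> (X i - y) - \<phi> (x - y)) / (X i - x)\<bar> \<le> C * (1 + B) ^ N / (1 + \<bar>y\<bar>) ^ N" for i y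
  proof -
    have "\<exists>\<xi>. \<bar>\<xi>\<bar> \<le> B \<and> \<phi> (X i - y) - \<phi> (x - y) = (X i - x) * deriv \<phi> (\<xi> - y)"
    proof (cases "x < X i")
      case True
      have "\<exists>z>x. z < X i \<and> \<phi> (X i - y) - \<phi> (x - y) = (X i - x) * deriv \<phi> (z - y)"
        by (rule MVT2[OF True, where f = "\<lambda>z. \<phi> (z - y)"])
          (rule d\<phi>_shift)
      then obtain z where "x < z" "z < X i" "\<phi> (X i - y) - \<phi> (x - y) = (X i - x) * deriv \<phi> (z - y)" by blast
      then show ?thesis using B[of i] \<open>\<bar>x\<bar> \<le> B\<close>
        by (intro exI[of _ z]) (auto simp: abs_le_iff)
    next
      case False
      then have less: "X i < x" using ne[of i] by simp
      have "\<exists>z>X i. z < x \<and> \<phi> (x - y) - \<phi> (X i - y) = (x - X i) * deriv \<phi> (z - y)"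
        by (rule MVT2[OF less, where f = "\<lambda>z. \<phi> (z - y)"])
          (rule d\<phi>_shift)
      then obtain z where "X i < z" "z < x" "\<phi> (x - y) - \<phi> (X i - y) = (x - X i) * deriv \<phi> (z - y)" by blast
      then show ?thesis using B[of i] \<open>\<bar>x\<bar> \<le> B\<close>
        by (intro exI[of _ z]) (auto simp: abs_le_iff algebra_simps)
    qed
    then obtain \<xi> where \<xi>: "\<bar>\<xi>\<bar> \<le> B" "\<phi> (X i - y) - \<phi> (x - y) = (X i - x) * deriv \<phi> (\<xi> - y)" by blast
    then have "\<bar>(\<phi> (X i - y) - \<phi> (x - y)) / (X i - x)\<bar> = \<bar>deriv \<phi> (\<xi> - y)\<bar>"
      using ne[of i] by simp
    also have "\<dots> \<le> C / (1 + \<bar>\<xi> - y\<bar>) ^ N" by (rule C)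
    also have "\<dots> \<le> C * ((1 + \<bar>\<xi>\<bar>) ^ N / (1 + \<bar>y\<bar>) ^ N)"
      using mult_left_mono[OF inverse_weight_shift[of \<xi> y N] \<open>C \<ge> 0\<close>] by simp
    also have "\<dots> \<le> C * ((1 + B) ^ N / (1 + \<bar>y\<bar>) ^ N)"
      using \<xi>(1) \<open>C \<ge> 0\<close> by (intro mult_left_mono divide_right_mono power_mono) auto
    finally show ?thesis by simp
  qed
  have "(\<lambda>i. LINT y|lborel. g y * ((\<phi> (X i - y) - \<phi> (x - y)) / (X i - x))) \<longlonglongrightarrow> (LINT y|lborel. g y * deriv \<phi> (x - y))"
  proof (rule integral_dominated_convergence)
    show "integrable lborel (\<lambda>y. C * (1 + B) ^ N * (\<bar>g y\<bar> / (1 + \<bar>y\<bar>) ^ N))"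
      by (intro integrable_mult_right tempered_abs_integrable g)
    show "AE y in lborel. norm (g y * ((\<phi> (X i - y) - \<phi> (x - y)) / (X i - x))) \<le> C * (1 + B) ^ N * (\<bar>g y\<bar> / (1 + \<bar>y\<bar>) ^ N)" for i
    proof (rule AE_I2)
      fix y
      show "norm (g y * ((\<phi> (X i - y) - \<phi> (x - y)) / (X i - x))) \<le> C * (1 + B) ^ N * (\<bar>g y\<bar> / (1 + \<bar>y\<bar>) ^ N)"
        using mult_left_mono[OF bd[of i y], of "\<bar>g y\<bar>"] unfolding real_norm_def abs_mult[of "g y"] by (simp add: mult_ac)
    qed
    show "AE y in lborel. (\<lambda>i. g y * ((\<phi> (X i - y) - \<phi> (x - y)) / (X i - x))) \<longlonglongrightarrow> g y * deriv \<phi> (x - y)"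
    proof (intro AE_I2 tendsto_mult_left)
      fix y
      show "(\<lambda>i. (\<phi> (X i - y) - \<phi> (x - y)) / (X i - x)) \<longlonglongrightarrow> deriv \<phi> (x - y)"
        using d\<phi>_shift[of y x] unfolding has_field_derivative_iff tendsto_at_iff_sequentially using X ne by (auto simp: o_def)
    qed
  qed measurable
  moreover have "(LINT y|lborel. g y * ((\<phi> (X i - y) - \<phi> (x - y)) / (X i - x))) = (convol g \<phi> (X i) - convol g \<phi> x) / (X i - x)" for i
    unfolding convol_flip
    using convol_integrable[OF g \<phi>]
    by (simp add: right_diff_distrib flip: Bochner_Integration.integral_diff)
  ultimately show "((\<lambda>y. (convol g \<phi> y - convol g \<phi> x) / (y - x)) \<circ> X) \<longlonglongrightarrow> convol g (deriv \<phi>) x"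
    unfolding o_def convol_flip[of g "deriv \<phi>"] by (simp only:)
qed

lemma LINT_abs_dilate:
  assumes "n \<ge> 1"
  shows "(LINT y|lborel. \<bar>dilate \<Phi> n y\<bar>) = (LINT y|lborel. \<bar>\<Phi> y\<bar>)"
  using lborel_integral_real_affine[of "real n" "\<lambda>y. \<bar>\<Phi> y\<bar>" 0] assms
  by (simp add: dilate_def abs_mult)

lemma LINT_dilate:
  assumes "n \<ge> 1"
  shows "(LINT y|lborel. dilate \<Phi> n y) = (LINT y|lborel. \<Phi> y)"
  using lborel_integral_real_affine[of "real n" "\<lambda>y. \<Phi> y" 0] assms
  by (simp add: dilate_def)

text \<open>For \<open>\<bar>y\<bar> \<le> \<delta>\<close> uniform continuity of \<open>g\<close>
  gives an error \<open>\<epsilon> * B\<close>; \<open>B\<close> is the integral of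
  \<open>\<bar>\<Phi>\<bar>\<close>, since \<open>\<Phi>\<close> may change sign. For larger
  \<open>\<bar>y\<bar>\<close> the decay of \<open>\<Phi>\<close> gives
  \<open>E / (real n * \<delta>\<^sup>2)\<close>.\<close>

lemma convol_dilate_limit:
  assumes g: "tempered N g" and \<Phi>: "mollifier \<Phi>"
  shows "uniform_limit {-R..R} (\<lambda>n. convol g (dilate \<Phi> n)) g sequentially"
proof (cases "R \<ge> 0")
  case True
  have s: "schwartz \<Phi>" and one: "(LINT y|lborel. \<Phi> y) = 1" using \<Phi> by (auto simp: mollifier_def)
  \<comment> \<open>At least \<open>N\<close>, so that \<open>g\<close> is integrable against the
    weight, and at least 3, so that the weight itself is integrable.\<close>
  define M where "M = N + 3"
  have gM: "tempered M g" using tempered_mono[OF g] by (simp add: M_def)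
  have cont: "continuous_on UNIV g" using g by (simp add: tempered_def)
  have [measurable]: "g \<in> borel_measurable borel"
    using cont by (rule borel_measurable_continuous_onI)
  \<comment> \<open>\<open>M\<close> powers supply the weight in \<open>y\<close>. The other two
    give \<open>1 / (real n * \<delta>)\<^sup>2\<close> off
    \<open>\<bar>y\<bar> \<le> \<delta>\<close>, which outweighs the factor \<open>real n\<close> in
    the dilation.\<close>
  obtain C where "C \<ge> 0" and C: "\<And>x. \<bar>\<Phi> x\<bar> \<le> C / (1 + \<bar>x\<bar>) ^ (M + 2)"
    using schwartz_decay[OF s, of "M + 2"] by blast
  define A where "A = (LINT y|lborel. \<bar>g y\<bar> / (1 + \<bar>y\<bar>) ^ M)"
  define W where "W = (LINT y|lborel. 1 / (1 + \<bar>y::real\<bar>) ^ M)"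
  define B where "B = (LINT y|lborel. \<bar>\<Phi> y\<bar>)"
  have "A \<ge> 0" "W \<ge> 0" "B \<ge> 0" by (auto simp: A_def W_def B_def intro!: integral_nonneg_AE)
  have W_int: "integrable lborel (\<lambda>y::real. 1 / (1 + \<bar>y\<bar>) ^ M)"
    using tempered_mono[of 3 "\<lambda>_. 1" M] integrable_weight by (simp add: tempered_def M_def)
  have "compact (g ` {-R..R})"
    by (intro compact_continuous_image continuous_on_subset[OF cont]) auto
  then obtain G where "G > 0" and G: "\<And>x. x \<in> {-R..R} \<Longrightarrow> \<bar>g x\<bar> \<le> G"
    by (auto dest!: compact_imp_bounded simp: bounded_pos)
  \<comment> \<open>The first summand bounds the tail with \<open>g (x - y)\<close>, after shifting
    the weight by \<open>x\<close>; the second bounds the tail with \<open>g x\<close>.\<close>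
  define E where "E = C * ((1 + R) ^ M * A + G * W)"
  have "E \<ge> 0" using \<open>C \<ge> 0\<close> \<open>A \<ge> 0\<close> \<open>W \<ge> 0\<close> \<open>G > 0\<close> True by (auto simp: E_def)
  have main: "\<bar>convol g (dilate \<Phi> n) x - g x\<bar> \<le> \<epsilon> * B + E / (real n * \<delta>\<^sup>2)"
    if x: "x \<in> {-R..R}" and n: "n \<ge> 1" and \<delta>: "\<delta> > 0" and "\<epsilon> > 0" and close: "\<And>y. \<bar>y\<bar> \<le> \<delta> \<Longrightarrow> \<bar>g (x - y) - g x\<bar> \<le> \<epsilon>"
    for x n \<delta> \<epsilon>
  proof -
    let ?\<Phi> = "dilate \<Phi> n"
    have sn: "schwartz ?\<Phi>" by (rule schwartz_dilate[OF s])
    have gx_int: "integrable lborel (\<lambda>y. g (x - y) * ?\<Phi> y)"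
      using lborel_integrable_real_affine[OF convol_integrable[OF g sn, of x], of "- 1" x] by simp
    have w_int: "integrable lborel (\<lambda>y. \<bar>g (x - y)\<bar> / (1 + \<bar>x - y\<bar>) ^ M)"
      using lborel_integrable_real_affine[OF tempered_abs_integrable[OF gM], of "- 1" x] by simp
    have w_eq: "(LINT y|lborel. \<bar>g (x - y)\<bar> / (1 + \<bar>x - y\<bar>) ^ M) = A"
      using lborel_integral_real_affine[of "- 1" "\<lambda>y. \<bar>g y\<bar> / (1 + \<bar>y\<bar>) ^ M" x] by (simp add: A_def)
    define h where "h y = \<epsilon> * \<bar>?\<Phi> y\<bar> + C / (real n * \<delta>\<^sup>2) * ((1 + R) ^ M * (\<bar>g (x - y)\<bar> / (1 + \<bar>x - y\<bar>) ^ M) + G * (1 / (1 + \<bar>y\<bar>) ^ M))" for y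
    note \<Phi>_int = integrable_mult_right[OF integrable_abs[OF schwartz_integrable[OF sn]], of \<epsilon>]
    note gw_int = integrable_mult_right[OF w_int, of "(1 + R) ^ M"]
    note Gw_int = integrable_mult_right[OF W_int, of G]
    note K_int = integrable_mult_right[OF Bochner_Integration.integrable_add[OF gw_int Gw_int], of "C / (real n * \<delta>\<^sup>2)"]
    have h_int: "integrable lborel h"
      unfolding h_def by (rule Bochner_Integration.integrable_add[OF \<Phi>_int K_int])
    have h_eq: "(LINT y|lborel. h y) = \<epsilon> * B + E / (real n * \<delta>\<^sup>2)"
    proof -
      have "(LINT y|lborel. h y) = \<epsilon> * (LINT y|lborel. \<bar>?\<Phi> y\<bar>) + C / (real n * \<delta>\<^sup>2) * ((1 + R) ^ M * A + G * W)"
        unfolding h_def Bochner_Integration.integral_add[OF \<Phi>_int K_int] integral_mult_right_zero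
          Bochner_Integration.integral_add[OF gw_int Gw_int] w_eq W_def ..
      then show ?thesis
        by (simp add: LINT_abs_dilate[OF n] B_def E_def)
    qed
    have "convol g ?\<Phi> x - g x = (LINT y|lborel. g (x - y) * ?\<Phi> y) - (LINT y|lborel. g x * ?\<Phi> y)"
      by (simp add: convol_def LINT_dilate[OF n] one)
    also have "\<dots> = (LINT y|lborel. g (x - y) * ?\<Phi> y - g x * ?\<Phi> y)"
      by (intro Bochner_Integration.integral_diff[symmetric] gx_int integrable_mult_right schwartz_integrable[OF sn])
    finally have eq: "convol g ?\<Phi> x - g x = (LINT y|lborel. g (x - y) * ?\<Phi> y - g x * ?\<Phi> y)" .
    have pt: "\<bar>g (x - y) * ?\<Phi> y - g x * ?\<Phi> y\<bar> \<le> h y" for y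
    proof (cases "\<bar>y\<bar> \<le> \<delta>")
      case True
      have "\<bar>g (x - y) * ?\<Phi> y - g x * ?\<Phi> y\<bar> = \<bar>g (x - y) - g x\<bar> * \<bar>?\<Phi> y\<bar>"
        by (simp add: abs_mult flip: left_diff_distrib)
      also have "\<dots> \<le> \<epsilon> * \<bar>?\<Phi> y\<bar>" using close[OF True] by (intro mult_right_mono) auto
      also have "\<dots> \<le> h y"
        using \<open>C \<ge> 0\<close> \<open>G > 0\<close> \<open>R \<ge> 0\<close> by (simp add: h_def)
      finally show ?thesis .
    next
      case False
      have ny: "real n * \<delta> \<le> 1 + \<bar>real n * y\<bar>" "1 + \<bar>y\<bar> \<le> 1 + \<bar>real n * y\<bar>"
      proof -
        have "real n * \<delta> \<le> real n * \<bar>y\<bar>" using False by (intro mult_left_mono) auto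
        then show "real n * \<delta> \<le> 1 + \<bar>real n * y\<bar>" by (simp add: abs_mult)
        have "1 * \<bar>y\<bar> \<le> real n * \<bar>y\<bar>" using n by (intro mult_right_mono) auto
        then show "1 + \<bar>y\<bar> \<le> 1 + \<bar>real n * y\<bar>" by (simp add: abs_mult)
      qed
      have "\<bar>?\<Phi> y\<bar> = real n * \<bar>\<Phi> (real n * y)\<bar>" by (simp add: dilate_def abs_mult)
      also have "\<dots> \<le> real n * (C / (1 + \<bar>real n * y\<bar>) ^ (M + 2))"
        by (intro mult_left_mono C) auto
      also have "\<dots> \<le> real n * (C / ((1 + \<bar>y\<bar>) ^ M * (real n * \<delta>)\<^sup>2))"
        unfolding power_add using \<open>C \<ge> 0\<close> ny \<delta> n
        by (intro mult_left_mono divide_left_mono mult_mono power_mono mult_pos_pos zero_less_power) auto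
      also have "\<dots> = C / (real n * \<delta>\<^sup>2) * (1 / (1 + \<bar>y\<bar>) ^ M)"
        using n \<delta> by (simp add: field_simps power2_eq_square)
      finally have \<Phi>_le: "\<bar>?\<Phi> y\<bar> \<le> C / (real n * \<delta>\<^sup>2) * (1 / (1 + \<bar>y\<bar>) ^ M)" .
      have "\<bar>g (x - y) * ?\<Phi> y - g x * ?\<Phi> y\<bar> = \<bar>g (x - y) - g x\<bar> * \<bar>?\<Phi> y\<bar>"
        by (simp add: abs_mult flip: left_diff_distrib)
      also have "\<dots> \<le> (\<bar>g (x - y)\<bar> + G) * (C / (real n * \<delta>\<^sup>2) * (1 / (1 + \<bar>y\<bar>) ^ M))"
        using G[OF x] \<open>G > 0\<close> by (intro mult_mono \<Phi>_le) auto
      also have "\<dots> = C / (real n * \<delta>\<^sup>2) * (\<bar>g (x - y)\<bar> * (1 / (1 + \<bar>y\<bar>) ^ M) + G * (1 / (1 + \<bar>y\<bar>) ^ M))"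
        by (simp only: distrib_left distrib_right mult_ac)
      also have "\<dots> \<le> C / (real n * \<delta>\<^sup>2) * ((1 + R) ^ M * (\<bar>g (x - y)\<bar> / (1 + \<bar>x - y\<bar>) ^ M) + G * (1 / (1 + \<bar>y\<bar>) ^ M))"
      proof (intro mult_left_mono add_right_mono)
        have "1 / (1 + \<bar>y\<bar>) ^ M \<le> (1 + \<bar>x\<bar>) ^ M / (1 + \<bar>x - y\<bar>) ^ M"
          using inverse_weight_shift[of x "x - y" M] by simp
        also have "\<dots> \<le> (1 + R) ^ M / (1 + \<bar>x - y\<bar>) ^ M"
          using x by (intro divide_right_mono power_mono) auto
        finally have "\<bar>g (x - y)\<bar> * (1 / (1 + \<bar>y\<bar>) ^ M) \<le> \<bar>g (x - y)\<bar> * ((1 + R) ^ M / (1 + \<bar>x - y\<bar>) ^ M)"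
          by (rule mult_left_mono) simp
        then show "\<bar>g (x - y)\<bar> * (1 / (1 + \<bar>y\<bar>) ^ M) \<le> (1 + R) ^ M * (\<bar>g (x - y)\<bar> / (1 + \<bar>x - y\<bar>) ^ M)"
          by (simp add: mult_ac)
      qed (use \<open>C \<ge> 0\<close> in auto)
      also have "\<dots> \<le> h y" using \<open>\<epsilon> > 0\<close> by (simp add: h_def)
      finally show ?thesis .
    qed
    have "\<bar>LINT y|lborel. g (x - y) * ?\<Phi> y - g x * ?\<Phi> y\<bar> \<le> (LINT y|lborel. \<bar>g (x - y) * ?\<Phi> y - g x * ?\<Phi> y\<bar>)"
      using integral_norm_bound[of lborel "\<lambda>y. g (x - y) * ?\<Phi> y - g x * ?\<Phi> y"] by simp
    also have "\<dots> \<le> (LINT y|lborel. h y)"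
      by (intro integral_mono integrable_abs Bochner_Integration.integrable_diff gx_int integrable_mult_right
          schwartz_integrable[OF sn] h_int pt)
    finally show ?thesis unfolding eq h_eq .
  qed
  \<comment> \<open>The margin 1 keeps \<open>x - y\<close> inside the interval, as
    \<open>\<delta> \<le> 1\<close>.\<close>
  have unif: "uniformly_continuous_on {-R-1..R+1} g"
    by (intro compact_uniformly_continuous continuous_on_subset[OF cont]) auto
  show ?thesis
  proof (rule uniform_limitI)
    fix e :: real assume "e > 0"
    define \<epsilon> where "\<epsilon> = e / (2 * (B + 1))"
    have "\<epsilon> > 0" "\<epsilon> * B < e / 2" using \<open>e > 0\<close> \<open>B \<ge> 0\<close> by (auto simp: \<epsilon>_def field_simps)
    obtain d where "d > 0" and d: "\<And>x y. x \<in> {-R-1..R+1} \<Longrightarrow> y \<in> {-R-1..R+1} \<Longrightarrow> dist y x < d \<Longrightarrow> dist (g y) (g x) < \<epsilon>"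
      using unif \<open>\<epsilon> > 0\<close> unfolding uniformly_continuous_on_def by metis
    define \<delta> where "\<delta> = min 1 (d / 2)"
    have \<delta>: "\<delta> > 0" using \<open>d > 0\<close> by (simp add: \<delta>_def)
    have close: "\<bar>g (x - y) - g x\<bar> \<le> \<epsilon>" if "x \<in> {-R..R}" "\<bar>y\<bar> \<le> \<delta>" for x y
    proof -
      have "x - y \<in> {-R-1..R+1}" "x \<in> {-R-1..R+1}" "dist (x - y) x < d"
        using that \<open>d > 0\<close> by (auto simp: \<delta>_def dist_real_def abs_le_iff)
      then show ?thesis using d[of x "x - y"] by (simp add: dist_real_def)
    qed
    obtain n0 :: nat where n0: "2 * E / (\<delta>\<^sup>2 * e) < real n0" using reals_Archimedean2 by blast
    \<comment> \<open>\<open>n = 0\<close> is excluded because \<open>dilate \<Phi> 0\<close> has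
      integral 0 and not 1.\<close>
    have "dist (convol g (dilate \<Phi> n) x) (g x) < e" if "n \<ge> max 1 n0" "x \<in> {-R..R}" for n x
    proof -
      have "2 * E / (\<delta>\<^sup>2 * e) < real n" using n0 that(1) by linarith
      then have "E / (real n * \<delta>\<^sup>2) < e / 2"
        using \<delta> \<open>e > 0\<close> that(1) by (simp add: field_simps)
      moreover have "\<bar>convol g (dilate \<Phi> n) x - g x\<bar> \<le> \<epsilon> * B + E / (real n * \<delta>\<^sup>2)"
        using that by (intro main \<delta> \<open>\<epsilon> > 0\<close> close) auto
      ultimately show ?thesis
        using \<open>\<epsilon> * B < e / 2\<close> unfolding dist_real_def by linarith
    qed
    then show "\<forall>\<^sub>F n in sequentially. \<forall>x\<in>{-R..R}. dist (convol g (dilate \<Phi> n) x) (g x) < e"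
      unfolding eventually_sequentially by blast
  qed
qed simp

subsection \<open>The integrating factor\<close>

lemma continuous_on_bounded_Icc_symmetric:
  fixes f :: "real \<Rightarrow> real"
  assumes "continuous_on UNIV f"
  shows "bounded (f ` {-R..R})"
  by (intro compact_imp_bounded compact_continuous_image continuous_on_subset[OF assms]) auto

lemma continuous_positive_lower_bound:
  fixes f :: "real \<Rightarrow> real"
  assumes "continuous_on UNIV f" "\<And>x. f x > 0"
  obtains b where "b > 0" "\<And>x. x \<in> {-R..R} \<Longrightarrow> b \<le> f x"
proof (cases "R \<ge> 0")
  case True
  have "continuous_on {-R..R} f" by (rule continuous_on_subset[OF assms(1)]) simp
  from continuous_attains_inf[OF _ _ this] True
  obtain z where "\<forall>x\<in>{-R..R}. f z \<le> f x" by auto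
  then show ?thesis using that[of "f z"] assms(2) by blast
next
  case False
  then show ?thesis using that[of 1] by simp
qed

lemma DERIV_imp_continuous_on_UNIV:
  fixes f :: "real \<Rightarrow> real"
  assumes "\<And>x. (f has_real_derivative f' x) (at x)"
  shows "continuous_on UNIV f"
  using assms by (auto intro: DERIV_isCont continuous_at_imp_continuous_on)

lemma uniform_limit_compact_iff:
  fixes f :: "'i \<Rightarrow> real \<Rightarrow> real"
  shows "(\<forall>K. compact K \<longrightarrow> uniform_limit K f g F) \<longleftrightarrow> (\<forall>R. uniform_limit {-R..R} f g F)"
proof (intro iffI allI impI)
  fix K :: "real set"
  assume "\<forall>R. uniform_limit {-R..R} f g F" "compact K"
  moreover obtain R where "\<And>x. x \<in> K \<Longrightarrow> \<bar>x\<bar> \<le> R"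
    using compact_imp_bounded[OF \<open>compact K\<close>] by (auto simp: bounded_iff)
  then have "K \<subseteq> {-R..R}" by force
  ultimately show "uniform_limit K f g F"
    using uniform_limit_on_subset by blast
qed auto

lemma converges_Ck_0: "converges_Ck 0 f g \<longleftrightarrow> (\<forall>R. uniform_limit {-R..R} f g sequentially)"
  using uniform_limit_compact_iff[of f g sequentially] by (simp add: converges_Ck_def)

lemma converges_Ck_1: "converges_Ck 1 f g \<longleftrightarrow> (\<forall>R. uniform_limit {-R..R} f g sequentially) \<and>
    (\<forall>R. uniform_limit {-R..R} (\<lambda>n. deriv (f n)) (deriv g) sequentially)"
proof -
  have "(\<forall>i\<le>(1::nat). P i) \<longleftrightarrow> P 0 \<and> P 1" for P
    by (auto simp: le_Suc_eq)
  then show ?thesis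
    using uniform_limit_compact_iff[of f g sequentially]
      uniform_limit_compact_iff[of "\<lambda>n. deriv (f n)" "deriv g" sequentially]
    by (simp add: converges_Ck_def)
qed

lemma Ck_0: "f \<in> Ck 0 \<longleftrightarrow> continuous_on UNIV f"
  by (simp add: Ck_def)

lemma Ck_1: "f \<in> Ck 1 \<longleftrightarrow> (\<forall>x. (f has_real_derivative deriv f x) (at x)) \<and> continuous_on UNIV (deriv f)"
  by (simp add: Ck_def DERIV_deriv_iff_real_differentiable)

lemma Ck_2: "f \<in> Ck 2 \<longleftrightarrow> (\<forall>x. (f has_real_derivative deriv f x) (at x)) \<and>
    (\<forall>x. (deriv f has_real_derivative deriv (deriv f) x) (at x)) \<and> continuous_on UNIV (deriv (deriv f))"
proof -
  have "(\<forall>i<(2::nat). P i) \<longleftrightarrow> P 0 \<and> P 1" for P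
    by (auto simp: less_Suc_eq numeral_2_eq_2)
  then show ?thesis
    by (simp add: Ck_def DERIV_deriv_iff_real_differentiable numeral_2_eq_2)
qed

text \<open>\<open>exp\<close> is not uniformly continuous on the line; boundedness of the limit
  confines the approximations to one compact interval for large \<open>n\<close>.\<close>

lemma uniform_limit_exp:
  fixes f :: "nat \<Rightarrow> real \<Rightarrow> real"
  assumes lim: "uniform_limit X f g sequentially" and "bounded (g ` X)"
  shows "uniform_limit X (\<lambda>n x. exp (f n x)) (\<lambda>x. exp (g x)) sequentially"
proof -
  obtain M where M: "\<And>x. x \<in> X \<Longrightarrow> \<bar>g x\<bar> \<le> M"
    using assms(2) by (auto simp: bounded_iff)
  show ?thesis
  proof (rule uniform_limit_compose_uniformly_continuous_on[OF lim])
    show "uniformly_continuous_on {-M-1..M+1} (exp :: real \<Rightarrow> real)"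
      by (intro compact_uniformly_continuous continuous_intros) auto
    show "\<forall>\<^sub>F n in sequentially. \<forall>x\<in>X. f n x \<in> {-M-1..M+1}"
      using uniform_limitD[OF lim zero_less_one]
    proof eventually_elim
      case (elim n)
      show ?case
      proof
        fix x assume "x \<in> X"
        then show "f n x \<in> {-M-1..M+1}" using elim M[of x] by (force simp: dist_real_def)
      qed
    qed
  qed auto
qed

text \<open>The mean value inequality for \<open>U n - V\<close>, started at \<open>0\<close>, where
  convergence is assumed.\<close>

lemma uniform_limit_antiderivative:
  fixes U u :: "nat \<Rightarrow> real \<Rightarrow> real"
  assumes U: "\<forall>\<^sub>F n in sequentially. \<forall>x\<in>{-R..R}. (U n has_real_derivative u n x) (at x)"
    and V: "\<And>x. x \<in> {-R..R} \<Longrightarrow> (V has_real_derivative v x) (at x)"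
    and lim: "uniform_limit {-R..R} u v sequentially" and lim0: "(\<lambda>n. U n 0) \<longlonglongrightarrow> V 0"
  shows "uniform_limit {-R..R} U V sequentially"
proof (cases "R \<ge> 0")
  case True
  show ?thesis
  proof (rule uniform_limitI)
    fix e :: real assume "e > 0"
    define d where "d = e / (2 * (R + 1))"
    have "d > 0" "d * R < e / 2" using \<open>e > 0\<close> True by (auto simp: d_def field_simps)
    have "\<forall>\<^sub>F n in sequentially. dist (U n 0) (V 0) < e / 2"
      using lim0 \<open>e > 0\<close> by (intro tendstoD) auto
    with U uniform_limitD[OF lim \<open>d > 0\<close>]
    show "\<forall>\<^sub>F n in sequentially. \<forall>x\<in>{-R..R}. dist (U n x) (V x) < e"
    proof eventually_elim
      case (elim n)
      show ?case
      proof
        fix x assume x: "x \<in> {-R..R}"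
        have "norm ((U n x - V x) - (U n 0 - V 0)) \<le> d * norm (x - 0)"
        proof (rule field_differentiable_bound[where S = "{-R..R}" and f = "\<lambda>x. U n x - V x" and f' = "\<lambda>x. u n x - v x"])
          show "((\<lambda>x. U n x - V x) has_real_derivative u n z - v z) (at z within {-R..R})" if "z \<in> {-R..R}" for z
            by (rule has_field_derivative_at_within, rule DERIV_diff) (use elim(1) V[OF that] that in auto)
          show "norm (u n z - v z) \<le> d" if "z \<in> {-R..R}" for z
            using elim(2) that by (force simp: dist_real_def)
        qed (use x True in auto)
        also have "\<dots> \<le> d * R" using x \<open>d > 0\<close> by (intro mult_left_mono) auto
        finally show "dist (U n x) (V x) < e"
          using \<open>d * R < e / 2\<close> elim(3) unfolding dist_real_def real_norm_def by linarith
      qed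
    qed
  qed
qed simp

section \<open>Regularized coefficients\<close>

lemma sigma2_beta_n_regular:
  assumes "continuous_on UNIV \<sigma>" "continuous_on UNIV \<beta>" and conv: "convolutions_defined \<sigma> \<beta>" and \<Phi>: "mollifier \<Phi>"
  shows "continuous_on UNIV (sigma2_n \<sigma> \<Phi> n)"
    and "(beta_n \<beta> \<Phi> n has_real_derivative deriv (beta_n \<beta> \<Phi> n) x) (at x)"
    and "continuous_on UNIV (deriv (beta_n \<beta> \<Phi> n))"
    and "uniform_limit {-R..R} (sigma2_n \<sigma> \<Phi>) (\<lambda>x. (\<sigma> x)\<^sup>2) sequentially"
proof -
  \<comment> \<open>\<open>convolutions_defined\<close> speaks only of dilated mollifiers, whose
    derivatives are not mollifiers; temperedness gives access to convolutions with those derivatives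
    as well.\<close>
  obtain N where N: "tempered N (\<lambda>x. (\<sigma> x)\<^sup>2)"
  proof -
    have "continuous_on UNIV (\<lambda>x. (\<sigma> x)\<^sup>2)" by (intro continuous_intros assms(1))
    moreover have "convolvable (\<lambda>x. (\<sigma> x)\<^sup>2) (dilate \<Phi> 1)" if "mollifier \<Phi>" for \<Phi>
      using conv that by (simp add: convolutions_defined_def)
    ultimately show ?thesis using that convolvable_imp_tempered by blast
  qed
  obtain M where M: "tempered M \<beta>"
  proof -
    have "convolvable \<beta> (dilate \<Phi> 1)" if "mollifier \<Phi>" for \<Phi>
      using conv that by (simp add: convolutions_defined_def)
    then show ?thesis using that convolvable_imp_tempered[OF assms(2)] by blast
  qed
  have s: "schwartz (dilate \<Phi> n)"
    using \<Phi> by (simp add: mollifier_def schwartz_dilate)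
  show "continuous_on UNIV (sigma2_n \<sigma> \<Phi> n)"
    unfolding sigma2_n_def by (rule DERIV_imp_continuous_on_UNIV) (rule DERIV_convol[OF N s])
  have b: "(beta_n \<beta> \<Phi> n has_real_derivative convol \<beta> (deriv (dilate \<Phi> n)) x) (at x)" for x
    unfolding beta_n_def by (rule DERIV_convol[OF M s])
  then have eq: "deriv (beta_n \<beta> \<Phi> n) = convol \<beta> (deriv (dilate \<Phi> n))"
    by (auto intro: DERIV_imp_deriv)
  show "(beta_n \<beta> \<Phi> n has_real_derivative deriv (beta_n \<beta> \<Phi> n) x) (at x)"
    unfolding eq by (rule b)
  show "continuous_on UNIV (deriv (beta_n \<beta> \<Phi> n))"
    unfolding eq by (rule DERIV_imp_continuous_on_UNIV) (rule DERIV_convol[OF M schwartz_deriv[OF s]])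
  show "uniform_limit {-R..R} (sigma2_n \<sigma> \<Phi>) (\<lambda>x. (\<sigma> x)\<^sup>2) sequentially"
    using convol_dilate_limit[OF N \<Phi>] by (simp add: sigma2_n_def[abs_def])
qed

text \<open>Since \<open>\<Phi>\<close> may change sign, \<open>sigma2_n\<close> can vanish somewhere for every \<open>n\<close>; it is
  replaced by a globally positive \<open>q n\<close> which agrees with it on each compact set for large \<open>n\<close>.\<close>

lemma regularized_coefficients:
  assumes \<sigma>: "continuous_on UNIV \<sigma>" "\<forall>x. \<sigma> x > 0" and \<beta>: "continuous_on UNIV \<beta>" and conv: "convolutions_defined \<sigma> \<beta>"
    and \<Phi>: "mollifier \<Phi>" and \<Sigma>: "is_Sigma \<sigma> \<beta> \<Sigma>"
  obtains q S where "\<And>n. continuous_on UNIV (q n)" "\<And>n x. q n x > 0"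
    "\<And>n x. (S n has_real_derivative 2 * deriv (beta_n \<beta> \<Phi> n) x / q n x) (at x)"
    "\<And>R. \<forall>\<^sub>F n in sequentially. \<forall>x\<in>{-R..R}. q n x = sigma2_n \<sigma> \<Phi> n x"
    "\<And>R. uniform_limit {-R..R} q (\<lambda>x. (\<sigma> x)\<^sup>2) sequentially"
    "\<And>R. uniform_limit {-R..R} S \<Sigma> sequentially"
proof -
  note reg = sigma2_beta_n_regular[OF \<sigma>(1) \<beta> conv \<Phi>]
  have s2_cont: "continuous_on UNIV (\<lambda>x. (\<sigma> x)\<^sup>2)" by (intro continuous_intros \<sigma>(1))
  have s2_pos: "(\<sigma> x)\<^sup>2 > 0" for x using \<sigma>(2) zero_less_power by blast
  \<comment> \<open>The floor \<open>(\<sigma> x)\<^sup>2 / 2\<close> is positive everywhere. On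
    \<open>{-R..R}\<close> it is inactive as soon as \<open>sigma2_n\<close> is within half a lower
    bound of \<open>\<sigma>\<^sup>2\<close> from its limit.\<close>
  define q where "q n x = max (sigma2_n \<sigma> \<Phi> n x) ((\<sigma> x)\<^sup>2 / 2)" for n x
  have q_cont: "continuous_on UNIV (q n)" for n
    unfolding q_def[abs_def] by (intro continuous_intros reg(1) \<sigma>(1)) auto
  have q_pos: "q n x > 0" for n x
    using s2_pos[of x] by (simp add: q_def less_max_iff_disj)
  have q_eq: "\<forall>\<^sub>F n in sequentially. \<forall>x\<in>{-R..R}. q n x = sigma2_n \<sigma> \<Phi> n x" for R
  proof -
    obtain b where "b > 0" and b: "\<And>x. x \<in> {-R..R} \<Longrightarrow> b \<le> (\<sigma> x)\<^sup>2"
      using continuous_positive_lower_bound[OF s2_cont s2_pos, of R] by blast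
    then have "b / 2 > 0" by simp
    from uniform_limitD[OF reg(4)[of R] this] show ?thesis
    proof eventually_elim
      case (elim n)
      show ?case
      proof
        fix x assume x: "x \<in> {-R..R}"
        then have "\<bar>sigma2_n \<sigma> \<Phi> n x - (\<sigma> x)\<^sup>2\<bar> < b / 2" using elim by (auto simp: dist_real_def)
        then show "q n x = sigma2_n \<sigma> \<Phi> n x" using b[OF x] unfolding q_def by (intro max_absorb1) linarith
      qed
    qed
  qed
  have integrand_cont: "continuous_on UNIV (\<lambda>x. 2 * deriv (beta_n \<beta> \<Phi> n) x / q n x)" for n
    using q_pos[of n] by (intro continuous_intros reg(3) q_cont) (auto simp: less_le)
  have "\<exists>S. S 0 = 0 \<and> (\<forall>x. (S has_real_derivative 2 * deriv (beta_n \<beta> \<Phi> n) x / q n x) (at x))" for n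
    using antiderivative_ex[OF integrand_cont[of n], of 0 0] by metis
  then obtain S where S0: "\<And>n. S n 0 = 0"
    and S: "\<And>n x. (S n has_real_derivative 2 * deriv (beta_n \<beta> \<Phi> n) x / q n x) (at x)"
    by metis
  \<comment> \<open>The denominator in \<open>is_Sigma\<close> may vanish somewhere for every
    \<open>n\<close>; on a compact set and for large \<open>n\<close> the integral agrees with
    \<open>S n\<close>, which carries the limit \<open>\<Sigma>\<close> over.\<close>
  have S_eq: "\<forall>\<^sub>F n in sequentially. \<forall>x\<in>{-R..R}.
      S n x = 2 * (LBINT y=ereal 0..ereal x. deriv (beta_n \<beta> \<Phi> n) y / sigma2_n \<sigma> \<Phi> n y)" for R
    using q_eq[of R]
  proof eventually_elim
    case (elim n)
    show ?case
    proof
      fix x assume x: "x \<in> {-R..R}"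
      have sub: "{min 0 x..max 0 x} \<subseteq> {-R..R}" using x by auto
      have eq: "deriv (beta_n \<beta> \<Phi> n) y / sigma2_n \<sigma> \<Phi> n y = deriv (beta_n \<beta> \<Phi> n) y / q n y"
        if "y \<in> {min 0 x..max 0 x}" for y
        using elim sub that by (auto simp: subset_iff)
      have "(LBINT y=ereal 0..ereal x. deriv (beta_n \<beta> \<Phi> n) y / sigma2_n \<sigma> \<Phi> n y) = S n x / 2 - S n 0 / 2"
      proof (rule interval_integral_FTC_finite)
        have "continuous_on UNIV (\<lambda>y. 1/2 * (2 * deriv (beta_n \<beta> \<Phi> n) y / q n y))"
          by (intro continuous_on_mult_left integrand_cont)
        then have "continuous_on {min 0 x..max 0 x} (\<lambda>y. deriv (beta_n \<beta> \<Phi> n) y / q n y)"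
          by (auto intro: continuous_on_subset)
        then show "continuous_on {min 0 x..max 0 x} (\<lambda>y. deriv (beta_n \<beta> \<Phi> n) y / sigma2_n \<sigma> \<Phi> n y)"
          using eq by (subst continuous_on_cong[OF refl]) auto
        show "((\<lambda>y. S n y / 2) has_vector_derivative deriv (beta_n \<beta> \<Phi> n) y / sigma2_n \<sigma> \<Phi> n y) (at y within {min 0 x..max 0 x})"
          if "min 0 x \<le> y" "y \<le> max 0 x" for y
        proof -
          have "((\<lambda>y. S n y / 2) has_real_derivative deriv (beta_n \<beta> \<Phi> n) y / q n y) (at y within {min 0 x..max 0 x})"
            using DERIV_cdivide[OF has_field_derivative_at_within[OF S[of n y]], where c = 2] by simp
          then show ?thesis
            using that by (subst eq) (simp_all add: has_real_derivative_iff_has_vector_derivative)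
        qed
      qed
      then show "S n x = 2 * (LBINT y=ereal 0..ereal x. deriv (beta_n \<beta> \<Phi> n) y / sigma2_n \<sigma> \<Phi> n y)"
        by (simp add: S0)
    qed
  qed
  show ?thesis
  proof (rule that[OF q_cont q_pos S q_eq])
    show "uniform_limit {-R..R} q (\<lambda>x. (\<sigma> x)\<^sup>2) sequentially" for R
      using reg(4)[of R] uniform_limit_cong[OF q_eq refl] by blast
    have "uniform_limit {-R..R} (\<lambda>n x. 2 * (LBINT y=ereal 0..ereal x. deriv (beta_n \<beta> \<Phi> n) y / sigma2_n \<sigma> \<Phi> n y)) \<Sigma> sequentially" for R
      using \<Sigma> \<Phi> unfolding is_Sigma_def converges_Ck_0 by blast
    then show "uniform_limit {-R..R} S \<Sigma> sequentially" for R
      using uniform_limit_cong[OF S_eq refl] by blast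
  qed
qed

text \<open>As \<open>deriv f\<close> is a priori only continuous, the product is not differentiated
  directly. Instead \<open>W n = exp (S n) * deriv (fs n)\<close> has two limits: the product
  itself, by convergence in C1, and an antiderivative \<open>V\<close> of the right-hand side,
  because the derivatives of \<open>W n\<close> converge too.\<close>

lemma C1_solution_imp_ode:
  assumes \<sigma>: "continuous_on UNIV \<sigma>" "\<forall>x. \<sigma> x > 0" and \<beta>: "continuous_on UNIV \<beta>" and conv: "convolutions_defined \<sigma> \<beta>"
    and \<Sigma>: "is_Sigma \<sigma> \<beta> \<Sigma>" and sol: "C1_solution \<sigma> \<beta> l f"
  shows "((\<lambda>x. exp (\<Sigma> x) * deriv f x) has_real_derivative 2 * exp (\<Sigma> x) * l x / (\<sigma> x)\<^sup>2) (at x)"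
proof -
  have s2_cont: "continuous_on UNIV (\<lambda>x. (\<sigma> x)\<^sup>2)" by (intro continuous_intros \<sigma>(1))
  have s2_pos: "(\<sigma> x)\<^sup>2 > 0" for x using \<sigma>(2) zero_less_power by blast
  obtain \<Phi> where \<Phi>: "mollifier \<Phi>" using mollifier_ex by blast
  obtain q S where q: "\<And>n. continuous_on UNIV (q n)" "\<And>n x. q n x > 0"
    and S: "\<And>n x. (S n has_real_derivative 2 * deriv (beta_n \<beta> \<Phi> n) x / q n x) (at x)"
    and q_eq: "\<And>R. \<forall>\<^sub>F n in sequentially. \<forall>x\<in>{-R..R}. q n x = sigma2_n \<sigma> \<Phi> n x"
    and q_lim: "\<And>R. uniform_limit {-R..R} q (\<lambda>x. (\<sigma> x)\<^sup>2) sequentially"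
    and S_lim: "\<And>R. uniform_limit {-R..R} S \<Sigma> sequentially"
    using regularized_coefficients[OF \<sigma> \<beta> conv \<Phi> \<Sigma>] by blast
  obtain fs ls where fs: "\<And>n. n \<ge> 1 \<Longrightarrow> fs n \<in> Ck 2" and L: "\<And>n. n \<ge> 1 \<Longrightarrow> L_n \<sigma> \<beta> \<Phi> n (fs n) = ls n"
    and fs_lim: "converges_Ck 1 fs f" and ls_lim: "converges_Ck 0 ls l"
    using sol \<Phi> unfolding C1_solution_def by blast
  have cont: "continuous_on UNIV \<Sigma>" "continuous_on UNIV l" "continuous_on UNIV (deriv f)"
    using \<Sigma> sol by (simp_all add: is_Sigma_def C1_solution_def Ck_0 Ck_1 del: One_nat_def)
  define w where "w x = 2 * exp (\<Sigma> x) * l x / (\<sigma> x)\<^sup>2" for x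
  have w_cont: "continuous_on UNIV w"
    unfolding w_def[abs_def] using \<sigma>(2) by (intro continuous_intros cont \<sigma>(1)) (auto simp: less_le)
  obtain V where V0: "V 0 = exp (\<Sigma> 0) * deriv f 0" and V: "\<And>x. (V has_real_derivative w x) (at x)"
    using antiderivative_ex[OF w_cont] by blast
  have V_eq: "V x = exp (\<Sigma> x) * deriv f x" for x
  proof -
    define R where "R = \<bar>x\<bar>"
    define W where "W n x = exp (S n x) * deriv (fs n) x" for n x
    define W' where "W' n x = exp (S n x) * (2 * deriv (beta_n \<beta> \<Phi> n) x / q n x) * deriv (fs n) x
      + exp (S n x) * deriv (deriv (fs n)) x" for n x
    have exp_lim: "uniform_limit {-R..R} (\<lambda>n x. exp (S n x)) (\<lambda>x. exp (\<Sigma> x)) sequentially"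
      by (intro uniform_limit_exp S_lim continuous_on_bounded_Icc_symmetric cont)
    have exp_bdd: "bounded ((\<lambda>x. exp (\<Sigma> x)) ` {-R..R})"
      by (intro continuous_on_bounded_Icc_symmetric continuous_intros cont)
    have W_lim: "uniform_limit {-R..R} W (\<lambda>x. exp (\<Sigma> x) * deriv f x) sequentially"
      unfolding W_def[abs_def] using fs_lim unfolding converges_Ck_1
      by (intro uniform_lim_mult exp_lim exp_bdd continuous_on_bounded_Icc_symmetric cont) auto
    have W_deriv: "\<forall>\<^sub>F n in sequentially. \<forall>x\<in>{-R..R}. (W n has_real_derivative W' n x) (at x)"
      using eventually_ge_at_top[of 1]
    proof eventually_elim
      case (elim n)
      then have "(deriv (fs n) has_real_derivative deriv (deriv (fs n)) x) (at x)" for x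
        using fs[of n] by (simp add: Ck_2)
      then show ?case
        unfolding W_def[abs_def] W'_def by (auto intro!: derivative_eq_intros S)
    qed
    have W'_eq: "\<forall>\<^sub>F n in sequentially. \<forall>x\<in>{-R..R}. 2 * exp (S n x) * ls n x / q n x = W' n x"
      using q_eq[of R] eventually_ge_at_top[of 1]
    proof eventually_elim
      case (elim n)
      show ?case
      proof
        fix x assume "x \<in> {-R..R}"
        then have ls_x: "ls n x = q n x / 2 * deriv (deriv (fs n)) x + deriv (beta_n \<beta> \<Phi> n) x * deriv (fs n) x"
          using elim L[of n] by (auto simp: L_n_def fun_eq_iff)
        show "2 * exp (S n x) * ls n x / q n x = W' n x"
          unfolding ls_x W'_def using q(2)[of n x] by (simp add: field_simps)
      qed
    qed
    obtain b where "b > 0" and b: "\<And>x. x \<in> {-R..R} \<Longrightarrow> b \<le> (\<sigma> x)\<^sup>2"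
      using continuous_positive_lower_bound[OF s2_cont s2_pos, of R] by blast
    then have b': "\<And>x. x \<in> {-R..R} \<Longrightarrow> b \<le> norm ((\<sigma> x)\<^sup>2)" by simp
    have "uniform_limit {-R..R} (\<lambda>n x. 2 * exp (S n x) * ls n x / q n x) w sequentially"
      unfolding w_def[abs_def]
    proof (rule uniform_lim_divide[OF _ q_lim _ b' \<open>b > 0\<close>])
      show "uniform_limit {-R..R} (\<lambda>n x. 2 * exp (S n x) * ls n x) (\<lambda>x. 2 * exp (\<Sigma> x) * l x) sequentially"
        using ls_lim unfolding converges_Ck_0
        by (intro uniform_lim_mult[OF uniform_lim_mult[OF uniform_limit_const]] uniform_lim_mult exp_lim exp_bdd continuous_on_bounded_Icc_symmetric cont continuous_intros) auto
      show "bounded ((\<lambda>x. 2 * exp (\<Sigma> x) * l x) ` {-R..R})"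
        by (intro continuous_on_bounded_Icc_symmetric continuous_intros cont)
    qed
    then have W'_lim: "uniform_limit {-R..R} W' w sequentially"
      using uniform_limit_cong[OF W'_eq refl] by blast
    have "(\<lambda>n. W n 0) \<longlonglongrightarrow> V 0"
      unfolding V0 by (rule tendsto_uniform_limitI[OF W_lim]) (simp add: R_def)
    from uniform_limit_antiderivative[OF W_deriv V W'_lim this]
    have V_lim: "uniform_limit {-R..R} W V sequentially" .
    have "x \<in> {-R..R}" by (auto simp: R_def)
    then show ?thesis
      using LIMSEQ_unique tendsto_uniform_limitI[OF V_lim] tendsto_uniform_limitI[OF W_lim] by blast
  qed
  have "V = (\<lambda>x. exp (\<Sigma> x) * deriv f x)" using V_eq by blast
  then show ?thesis using V[of x] by (simp add: w_def)
qed

text \<open>For each mollifier the regularized system is solved with the given \<open>l\<close> and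
  the initial data of \<open>f\<close> at \<open>0\<close>. Its coefficients converge locally
  uniformly, hence so do its solutions and their first derivatives.\<close>

lemma ode_imp_C1_solution:
  assumes \<sigma>: "continuous_on UNIV \<sigma>" "\<forall>x. \<sigma> x > 0" and \<beta>: "continuous_on UNIV \<beta>" and conv: "convolutions_defined \<sigma> \<beta>"
    and \<Sigma>: "is_Sigma \<sigma> \<beta> \<Sigma>" and l: "l \<in> Ck 0" and f: "f \<in> Ck 1"
    and ode: "\<And>x. ((\<lambda>x. exp (\<Sigma> x) * deriv f x) has_real_derivative 2 * exp (\<Sigma> x) * l x / (\<sigma> x)\<^sup>2) (at x)"
  shows "C1_solution \<sigma> \<beta> l f"
  unfolding C1_solution_def
proof (intro conjI allI impI l f)
  fix \<Phi> assume \<Phi>: "mollifier \<Phi>"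
  have s2_cont: "continuous_on UNIV (\<lambda>x. (\<sigma> x)\<^sup>2)" by (intro continuous_intros \<sigma>(1))
  have s2_pos: "(\<sigma> x)\<^sup>2 > 0" for x using \<sigma>(2) zero_less_power by blast
  note reg = sigma2_beta_n_regular[OF \<sigma>(1) \<beta> conv \<Phi>]
  obtain q S where q: "\<And>n. continuous_on UNIV (q n)" "\<And>n x. q n x > 0"
    and S: "\<And>n x. (S n has_real_derivative 2 * deriv (beta_n \<beta> \<Phi> n) x / q n x) (at x)"
    and q_eq: "\<And>R. \<forall>\<^sub>F n in sequentially. \<forall>x\<in>{-R..R}. q n x = sigma2_n \<sigma> \<Phi> n x"
    and q_lim: "\<And>R. uniform_limit {-R..R} q (\<lambda>x. (\<sigma> x)\<^sup>2) sequentially"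
    and S_lim: "\<And>R. uniform_limit {-R..R} S \<Sigma> sequentially"
    using regularized_coefficients[OF \<sigma> \<beta> conv \<Phi> \<Sigma>] by blast
  have cont: "continuous_on UNIV \<Sigma>" "continuous_on UNIV l" "continuous_on UNIV (deriv f)"
    using \<Sigma> l f by (simp_all add: is_Sigma_def Ck_0 Ck_1 del: One_nat_def)
  have S_cont: "continuous_on UNIV (S n)" for n
    by (rule DERIV_imp_continuous_on_UNIV) (rule S)
  have q_nz: "q n x \<noteq> 0" for n x using q(2)[of n x] by simp
  define w where "w n x = 2 * exp (S n x) * l x / q n x" for n x
  have w_cont: "continuous_on UNIV (w n)" for n
    unfolding w_def[abs_def] by (intro continuous_intros cont S_cont q) (simp add: q_nz)
  have "\<exists>T. T 0 = exp (\<Sigma> 0) * deriv f 0 \<and> (\<forall>x. (T has_real_derivative w n x) (at x))" for n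
    using antiderivative_ex[OF w_cont] by metis
  then obtain T where T0: "\<And>n. T n 0 = exp (\<Sigma> 0) * deriv f 0" and T: "\<And>n x. (T n has_real_derivative w n x) (at x)"
    by metis
  define P where "P n x = exp (- S n x) * T n x" for n x
  \<comment> \<open>The product rule for \<open>exp (- S n x) * T n x\<close>, solved for the second
    derivative in \<open>L_n\<close> with \<open>q n\<close> in place of
    \<open>sigma2_n\<close>.\<close>
  define P' where "P' n x = 2 * l x / q n x - 2 * deriv (beta_n \<beta> \<Phi> n) x / q n x * P n x" for n x
  have P: "(P n has_real_derivative P' n x) (at x)" for n x
  proof -
    have "exp (- S n x) * w n x = 2 * l x / q n x"
      by (simp add: w_def exp_minus)
    then show ?thesis
      unfolding P_def[abs_def] P'_def
      by (auto intro!: derivative_eq_intros S T simp: P_def algebra_simps)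
  qed
  have P_cont: "continuous_on UNIV (P n)" for n
    by (rule DERIV_imp_continuous_on_UNIV) (rule P)
  have P'_cont: "continuous_on UNIV (P' n)" for n
    unfolding P'_def[abs_def] by (intro continuous_intros cont q P_cont reg(3)) (simp_all add: q_nz)
  have "\<exists>g. g 0 = f 0 \<and> (\<forall>x. (g has_real_derivative P n x) (at x))" for n
    using antiderivative_ex[OF P_cont] by metis
  then obtain fs where fs0: "\<And>n. fs n 0 = f 0" and fs: "\<And>n x. (fs n has_real_derivative P n x) (at x)"
    by metis
  have d1: "deriv (fs n) = P n" for n
    by (rule ext, rule DERIV_imp_deriv, rule fs)
  have d2: "deriv (P n) = P' n" for n
    by (rule ext, rule DERIV_imp_deriv, rule P)
  \<comment> \<open>\<open>L_n\<close> contains \<open>sigma2_n\<close> and not \<open>q n\<close>,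
    so \<open>ls n\<close> equals \<open>l\<close> only on compact sets and for large
    \<open>n\<close>, which suffices for the convergence.\<close>
  define ls where "ls n = L_n \<sigma> \<beta> \<Phi> n (fs n)" for n
  have ls_eq: "ls n x = sigma2_n \<sigma> \<Phi> n x / 2 * P' n x + deriv (beta_n \<beta> \<Phi> n) x * P n x" for n x
    by (simp add: ls_def L_n_def d1 d2)
  have ls_cont: "continuous_on UNIV (ls n)" for n
    unfolding ls_eq[abs_def] by (intro continuous_intros reg(1) reg(3) P_cont P'_cont) auto
  have ls_lim: "uniform_limit {-R..R} ls l sequentially" for R
  proof -
    have "\<forall>\<^sub>F n in sequentially. \<forall>x\<in>{-R..R}. ls n x = l x"
      using q_eq[of R]
    proof eventually_elim
      case (elim n)
      show ?case
      proof
        fix x assume "x \<in> {-R..R}"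
        then have "ls n x = q n x / 2 * P' n x + deriv (beta_n \<beta> \<Phi> n) x * P n x"
          using elim by (simp add: ls_eq)
        then show "ls n x = l x"
          using q_nz[of n x] by (simp add: P'_def field_simps)
      qed
    qed
    from uniform_limit_cong[OF this refl] show ?thesis
      using uniform_limit_const by blast
  qed
  have P_lim: "uniform_limit {-R..R} P (deriv f) sequentially" if "R \<ge> 0" for R
  proof -
    have exp_lim: "uniform_limit {-R..R} (\<lambda>n x. exp (S n x)) (\<lambda>x. exp (\<Sigma> x)) sequentially"
      by (intro uniform_limit_exp S_lim continuous_on_bounded_Icc_symmetric cont)
    have exp_bdd: "bounded ((\<lambda>x. exp (\<Sigma> x)) ` {-R..R})"
      by (intro continuous_on_bounded_Icc_symmetric continuous_intros cont)
    have exp_minus_lim: "uniform_limit {-R..R} (\<lambda>n x. exp (- S n x)) (\<lambda>x. exp (- \<Sigma> x)) sequentially"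
      by (intro uniform_limit_exp uniform_limit_uminus S_lim continuous_on_bounded_Icc_symmetric continuous_intros cont)
    obtain b where "b > 0" and b: "\<And>x. x \<in> {-R..R} \<Longrightarrow> b \<le> (\<sigma> x)\<^sup>2"
      using continuous_positive_lower_bound[OF s2_cont s2_pos, of R] by blast
    then have b': "\<And>x. x \<in> {-R..R} \<Longrightarrow> b \<le> norm ((\<sigma> x)\<^sup>2)" by simp
    have w_lim: "uniform_limit {-R..R} w (\<lambda>x. 2 * exp (\<Sigma> x) * l x / (\<sigma> x)\<^sup>2) sequentially"
      unfolding w_def[abs_def]
    proof (rule uniform_lim_divide[OF _ q_lim _ b' \<open>b > 0\<close>])
      show "uniform_limit {-R..R} (\<lambda>n x. 2 * exp (S n x) * l x) (\<lambda>x. 2 * exp (\<Sigma> x) * l x) sequentially"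
        by (intro uniform_lim_mult uniform_limit_const exp_lim exp_bdd continuous_on_bounded_Icc_symmetric cont continuous_intros)
      show "bounded ((\<lambda>x. 2 * exp (\<Sigma> x) * l x) ` {-R..R})"
        by (intro continuous_on_bounded_Icc_symmetric continuous_intros cont)
    qed
    have T_lim: "uniform_limit {-R..R} T (\<lambda>x. exp (\<Sigma> x) * deriv f x) sequentially"
      by (rule uniform_limit_antiderivative[OF _ ode w_lim]) (simp_all add: T T0)
    have "uniform_limit {-R..R} P (\<lambda>x. exp (- \<Sigma> x) * (exp (\<Sigma> x) * deriv f x)) sequentially"
      unfolding P_def[abs_def]
      by (intro uniform_lim_mult exp_minus_lim T_lim continuous_on_bounded_Icc_symmetric cont continuous_intros)
    moreover have "(\<lambda>x. exp (- \<Sigma> x) * (exp (\<Sigma> x) * deriv f x)) = deriv f"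
      by (simp add: fun_eq_iff flip: mult.assoc exp_add)
    ultimately show ?thesis by simp
  qed
  have fs_lim: "uniform_limit {-R..R} fs f sequentially" if "R \<ge> 0" for R
    by (rule uniform_limit_antiderivative[OF _ _ P_lim[OF that]]) (use f in \<open>simp_all add: fs fs0 Ck_1 del: One_nat_def\<close>)
  show "\<exists>fs ls. (\<forall>n\<ge>1. fs n \<in> Ck 2 \<and> ls n \<in> Ck 0 \<and> L_n \<sigma> \<beta> \<Phi> n (fs n) = ls n) \<and>
                 converges_Ck 1 fs f \<and> converges_Ck 0 ls l"
  proof (intro exI conjI allI impI)
    show "fs n \<in> Ck 2" for n
      using fs P P'_cont by (simp add: Ck_2 d1 d2)
    show "ls n \<in> Ck 0" for n using ls_cont by (simp add: Ck_0)
    show "L_n \<sigma> \<beta> \<Phi> n (fs n) = ls n" for n by (simp add: ls_def)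
    show "converges_Ck 1 fs f"
      unfolding converges_Ck_1 d1
    proof (intro conjI allI)
      fix R
      show "uniform_limit {-R..R} fs f sequentially"
        by (cases "R \<ge> 0") (simp_all add: fs_lim)
      show "uniform_limit {-R..R} P (deriv f) sequentially"
        by (cases "R \<ge> 0") (simp_all add: P_lim)
    qed
    show "converges_Ck 0 ls l"
      unfolding converges_Ck_0 using ls_lim by blast
  qed
qed

subsection \<open>Reduction to the first-order system\<close>

lemma DERIV_within_Icc_unique:
  fixes f :: "real \<Rightarrow> real"
  assumes "a < b" "x \<in> {a..b}" "(f has_real_derivative D) (at x within {a..b})" "(f has_real_derivative E) (at x within {a..b})"
  shows "D = E"
  using vector_derivative_unique_within_closed_interval[of a b x f D E] assms
  by (simp add: has_real_derivative_iff_has_vector_derivative)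

lemma equal_DERIV_within_Icc:
  fixes f g :: "real \<Rightarrow> real"
  assumes "\<And>x. x \<in> {a..b} \<Longrightarrow> (f has_real_derivative D x) (at x within {a..b})"
    and "\<And>x. x \<in> {a..b} \<Longrightarrow> (g has_real_derivative D x) (at x within {a..b})"
    and "f a = g a" "x \<in> {a..b}"
  shows "f x = g x"
proof -
  have "\<exists>c. \<forall>x\<in>{a..b}. f x - g x = c"
    by (rule has_field_derivative_zero_constant) (use DERIV_diff[OF assms(1,2)] in auto)
  then obtain c where c: "\<And>x. x \<in> {a..b} \<Longrightarrow> f x - g x = c" by blast
  show ?thesis
    using c[of x] c[of a] assms(3,4) by auto
qed

lemma bvp_solution_nonlinear_imp_system:
  assumes \<sigma>: "continuous_on UNIV \<sigma>" "\<forall>x. \<sigma> x > 0" and \<beta>: "continuous_on UNIV \<beta>" and conv: "convolutions_defined \<sigma> \<beta>"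
    and \<Sigma>: "is_Sigma \<sigma> \<beta> \<Sigma>" and "a < b" and sol: "bvp_solution_nonlinear \<sigma> \<beta> a b A B F u"
  obtains P where "u a = A" "u b = B"
    "\<And>x. x \<in> {a..b} \<Longrightarrow> (u has_real_derivative exp (- \<Sigma> x) * P x) (at x within {a..b})"
    "\<And>x. x \<in> {a..b} \<Longrightarrow> (P has_real_derivative 2 * exp (\<Sigma> x) / (\<sigma> x)\<^sup>2 * F (x, u x, exp (- \<Sigma> x) * P x)) (at x within {a..b})"
proof -
  obtain u' gt ut where u': "\<And>x. x \<in> {a..b} \<Longrightarrow> (u has_real_derivative u' x) (at x within {a..b})"
    and gt: "\<And>x. x \<in> {a..b} \<Longrightarrow> gt x = F (x, u x, u' x)"
    and ut: "ut \<in> Ck 1" "\<And>x. x \<in> {a..b} \<Longrightarrow> ut x = u x" "C1_solution \<sigma> \<beta> gt ut" "ut a = A" "ut b = B"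
    using sol unfolding bvp_solution_nonlinear_def bvp_solution_def by blast
  define P where "P x = exp (\<Sigma> x) * deriv ut x" for x
  have dut: "deriv ut x = exp (- \<Sigma> x) * P x" for x
    by (simp add: P_def flip: mult.assoc exp_add)
  have du: "(u has_real_derivative deriv ut x) (at x within {a..b})" if x: "x \<in> {a..b}" for x
  proof (rule has_field_derivative_transform_within[OF _ zero_less_one x])
    show "(ut has_real_derivative deriv ut x) (at x within {a..b})"
      using ut(1) unfolding Ck_1 by (blast intro: has_field_derivative_at_within)
  qed (rule ut(2))
  have P: "(P has_real_derivative 2 * exp (\<Sigma> x) * gt x / (\<sigma> x)\<^sup>2) (at x)" for x
    unfolding P_def by (rule C1_solution_imp_ode[OF \<sigma> \<beta> conv \<Sigma> ut(3)])
  \<comment> \<open>The derivative \<open>u'\<close> chosen in the definition equals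
    \<open>deriv ut\<close> on all of \<open>[a,b]\<close>, by uniqueness of one-sided derivatives
    at the endpoints too.\<close>
  have gt_eq: "gt x = F (x, u x, exp (- \<Sigma> x) * P x)" if x: "x \<in> {a..b}" for x
    using gt[OF x] DERIV_within_Icc_unique[OF \<open>a < b\<close> x u'[OF x] du[OF x]] by (simp add: dut)
  have dP: "(P has_real_derivative 2 * exp (\<Sigma> x) / (\<sigma> x)\<^sup>2 * F (x, u x, exp (- \<Sigma> x) * P x)) (at x within {a..b})"
    if "x \<in> {a..b}" for x
    using has_field_derivative_at_within[OF P[of x], of "{a..b}"] by (simp add: gt_eq[OF that])
  show ?thesis
  proof (rule that)
    show "u a = A" "u b = B" using ut(2)[of a] ut(2)[of b] ut(4,5) \<open>a < b\<close> by auto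
    show "(u has_real_derivative exp (- \<Sigma> x) * P x) (at x within {a..b})" if "x \<in> {a..b}" for x
      using du[OF that] by (simp add: dut)
  qed (rule dP)
qed

text \<open>The definition asks for extensions to the whole line. The right-hand side, by now a
  function of \<open>x\<close> alone, is continued by its endpoint values, and the system becomes
  two integrations started at \<open>a\<close>. On \<open>[a,b]\<close> these reproduce
  \<open>P\<close> and \<open>u\<close>.\<close>

lemma system_imp_bvp_solution_nonlinear:
  assumes \<sigma>: "continuous_on UNIV \<sigma>" "\<forall>x. \<sigma> x > 0" and \<beta>: "continuous_on UNIV \<beta>" and conv: "convolutions_defined \<sigma> \<beta>"
    and \<Sigma>: "is_Sigma \<sigma> \<beta> \<Sigma>" and "a < b" and F: "continuous_on ({a..b} \<times> UNIV) F"
    and u: "\<And>x. x \<in> {a..b} \<Longrightarrow> (u has_real_derivative exp (- \<Sigma> x) * P x) (at x within {a..b})"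
    and P: "\<And>x. x \<in> {a..b} \<Longrightarrow> (P has_real_derivative 2 * exp (\<Sigma> x) / (\<sigma> x)\<^sup>2 * F (x, u x, exp (- \<Sigma> x) * P x)) (at x within {a..b})"
    and bc: "u a = A" "u b = B"
  shows "bvp_solution_nonlinear \<sigma> \<beta> a b A B F u"
proof -
  have cont: "continuous_on UNIV \<Sigma>" using \<Sigma> by (simp add: is_Sigma_def Ck_0)
  have uP_cont: "continuous_on {a..b} u" "continuous_on {a..b} P"
    by (rule DERIV_continuous_on, rule u, assumption) (rule DERIV_continuous_on, rule P)
  define u' where "u' x = exp (- \<Sigma> x) * P x" for x
  have u'_cont: "continuous_on {a..b} u'"
    unfolding u'_def by (intro continuous_intros uP_cont continuous_on_subset[OF cont]) auto
  define g where "g x = F (x, u x, u' x)" for x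
  have g_cont: "continuous_on {a..b} g"
    unfolding g_def
    by (rule continuous_on_compose2[OF F]) (auto intro!: continuous_intros uP_cont u'_cont)
  define gt where "gt x = g (max a (min b x))" for x
  have gt_cont: "continuous_on UNIV gt"
    unfolding gt_def
    by (rule continuous_on_compose2[OF g_cont]) (use \<open>a < b\<close> in \<open>auto intro!: continuous_intros\<close>)
  have gt_eq: "gt x = g x" if "x \<in> {a..b}" for x
  proof -
    have "max a (min b x) = x" using that by auto
    then show ?thesis by (simp add: gt_def)
  qed
  have s2: "(\<sigma> x)\<^sup>2 \<noteq> 0" for x using \<sigma>(2) by (simp add: less_imp_neq[symmetric])
  have "continuous_on UNIV (\<lambda>x. 2 * exp (\<Sigma> x) * gt x / (\<sigma> x)\<^sup>2)"
    by (intro continuous_intros cont \<sigma>(1) gt_cont) (use s2 in auto)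
  then obtain W where Wa: "W a = P a" and W: "\<And>x. (W has_real_derivative 2 * exp (\<Sigma> x) * gt x / (\<sigma> x)\<^sup>2) (at x)"
    using antiderivative_ex[of _ a "P a"] by blast
  have WP: "W x = P x" if "x \<in> {a..b}" for x
  proof (rule equal_DERIV_within_Icc[where f = W and g = P, OF has_field_derivative_at_within[OF W] _ Wa that])
    show "(P has_real_derivative 2 * exp (\<Sigma> x) * gt x / (\<sigma> x)\<^sup>2) (at x within {a..b})" if "x \<in> {a..b}" for x
      using P[OF that] by (simp add: gt_eq[OF that] g_def u'_def)
  qed
  have W_cont: "continuous_on UNIV W" by (rule DERIV_imp_continuous_on_UNIV) (rule W)
  have eW_cont: "continuous_on UNIV (\<lambda>x. exp (- \<Sigma> x) * W x)"
    by (intro continuous_intros cont W_cont)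
  then obtain ut where uta: "ut a = A" and ut: "\<And>x. (ut has_real_derivative exp (- \<Sigma> x) * W x) (at x)"
    using antiderivative_ex[of _ a A] by blast
  have ut_eq: "ut x = u x" if "x \<in> {a..b}" for x
  proof (rule equal_DERIV_within_Icc[where f = ut and g = u, OF has_field_derivative_at_within[OF ut] _ _ that])
    show "(u has_real_derivative exp (- \<Sigma> x) * W x) (at x within {a..b})" if "x \<in> {a..b}" for x
      using u[OF that] by (simp add: WP[OF that])
  qed (simp add: uta bc)
  have deriv_ut: "deriv ut = (\<lambda>x. exp (- \<Sigma> x) * W x)"
    by (rule ext, rule DERIV_imp_deriv, rule ut)
  have ut_C1: "ut \<in> Ck 1"
    using ut eW_cont unfolding Ck_1 deriv_ut by blast
  have gt_C0: "gt \<in> Ck 0" using gt_cont by (simp add: Ck_0)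
  have W_eq: "(\<lambda>x. exp (\<Sigma> x) * deriv ut x) = W"
    unfolding deriv_ut by (simp add: fun_eq_iff flip: mult.assoc exp_add)
  have "C1_solution \<sigma> \<beta> gt ut"
    by (rule ode_imp_C1_solution[OF \<sigma> \<beta> conv \<Sigma> gt_C0 ut_C1]) (simp only: W_eq W)
  moreover have "ut b = B" using ut_eq[of b] bc \<open>a < b\<close> by simp
  ultimately have "bvp_solution \<sigma> \<beta> a b A B g u"
    unfolding bvp_solution_def using gt_C0 gt_eq ut_C1 ut_eq uta by blast
  moreover have "(u has_real_derivative u' x) (at x within {a..b})" if "x \<in> {a..b}" for x
    using u[OF that] by (simp add: u'_def)
  ultimately show ?thesis
    unfolding bvp_solution_nonlinear_def g_def[abs_def] using u'_cont by blast
qed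

text \<open>Only the values on \<open>[a,b]\<close> enter \<open>bvp_solution_nonlinear\<close>;
  \<open>extensional\<close> picks one total function for each solution, so that uniqueness can be
  an equality of functions.\<close>

theorem corollary3p11:
  fixes \<sigma> \<beta> :: "real \<Rightarrow> real" and a b A B :: real
    and F :: "real \<times> real \<times> real \<Rightarrow> real"
  assumes "continuous_on UNIV \<sigma>" and "\<forall>x. \<sigma> x > 0" and "continuous_on UNIV \<beta>"
    and "convolutions_defined \<sigma> \<beta>"
    and "\<exists>\<Sigma>. is_Sigma \<sigma> \<beta> \<Sigma>"
    and "a < b"
    and "continuous_on ({a..b} \<times> UNIV) F"
    and "\<exists>c. \<forall>x\<in>{a..b}. \<forall>y. \<bar>F (x, y, 0)\<bar> \<le> c * (1 + \<bar>y\<bar>)"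
    and "\<forall>x\<in>{a..b}. \<forall>y y' z. (F (x, y, z) - F (x, y', z)) * (y - y') \<ge> 0"
    and "\<exists>k. \<forall>x\<in>{a..b}. \<forall>y z z'. \<bar>F (x, y, z) - F (x, y, z')\<bar> \<le> k * \<bar>z - z'\<bar>"
  shows "\<exists>!u. u \<in> extensional {a..b} \<and> bvp_solution_nonlinear \<sigma> \<beta> a b A B F u"
proof -
  note \<sigma> = assms(1,2) and F = assms(7)
  obtain \<Sigma> where \<Sigma>: "is_Sigma \<sigma> \<beta> \<Sigma>" using assms(5) by blast
  note coeffs = \<sigma> assms(3,4) \<Sigma> assms(6)
  obtain k where k: "\<And>x y z z'. x \<in> {a..b} \<Longrightarrow> \<bar>F (x, y, z) - F (x, y, z')\<bar> \<le> k * \<bar>z - z'\<bar>"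
    using assms(10) by blast
  have cont: "continuous_on UNIV \<Sigma>" using \<Sigma> by (simp add: is_Sigma_def Ck_0)
  define e where "e x = exp (- \<Sigma> x)" for x
  define w where "w x = 2 * exp (\<Sigma> x) / (\<sigma> x)\<^sup>2" for x
  have s2: "(\<sigma> x)\<^sup>2 \<noteq> 0" for x using \<sigma>(2) by (simp add: less_imp_neq[symmetric])
  have e: "continuous_on UNIV e" "\<And>x. e x > 0"
    by (auto simp: e_def[abs_def] intro!: continuous_intros cont)
  have w: "continuous_on UNIV w" "w x \<ge> 0" for x
    using s2 by (auto simp: w_def[abs_def] intro!: continuous_intros cont \<sigma>(1))
  \<comment> \<open>The right-hand side of the equation for \<open>P = exp \<Sigma> * u'\<close>,
    with \<open>u' = e x * q\<close>. The weight \<open>w\<close> is nonnegative, so the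
    monotonicity in \<open>y\<close> survives.\<close>
  define H where "H x y q = w x * F (x, y, e x * q)" for x y q
  obtain C where "C > 0" and C: "\<And>x. x \<in> {a..b} \<Longrightarrow> \<bar>w x * e x\<bar> \<le> C"
    using continuous_on_Icc_bounded[of a b "\<lambda>x. w x * e x"] continuous_on_subset[OF continuous_on_mult[OF w(1) e(1)]]
    by blast
  \<comment> \<open>The substitution multiplies the Lipschitz constant by
    \<open>w x * e x = 2 / (\<sigma> x)\<^sup>2\<close>, which \<open>C\<close> bounds on
    \<open>[a,b]\<close>; \<open>\<bar>k\<bar>\<close> saves a discussion of the sign of
    \<open>k\<close>.\<close>
  define K where "K = C * \<bar>k\<bar>"
  have "K \<ge> 0" using \<open>C > 0\<close> by (simp add: K_def)
  have H_lip: "\<bar>H x y q - H x y q'\<bar> \<le> K * \<bar>q - q'\<bar>" if x: "x \<in> {a..b}" for x y q q'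
  proof -
    have "\<bar>H x y q - H x y q'\<bar> = w x * \<bar>F (x, y, e x * q) - F (x, y, e x * q')\<bar>"
      using w(2)[of x] by (simp add: H_def abs_mult flip: right_diff_distrib)
    also have "\<dots> \<le> w x * (\<bar>k\<bar> * \<bar>e x * q - e x * q'\<bar>)"
      using k[OF x, of y "e x * q" "e x * q'"] mult_right_mono[of k "\<bar>k\<bar>" "\<bar>e x * q - e x * q'\<bar>"] w(2)[of x]
      by (intro mult_left_mono) linarith+
    also have "\<dots> = \<bar>w x * e x\<bar> * (\<bar>k\<bar> * \<bar>q - q'\<bar>)"
      using w(2)[of x] e(2)[of x] by (simp add: abs_mult flip: right_diff_distrib)
    also have "\<dots> \<le> C * (\<bar>k\<bar> * \<bar>q - q'\<bar>)"
      by (intro mult_right_mono C x) auto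
    finally show ?thesis by (simp add: K_def)
  qed
  have H_mono: "H x y q \<le> H x y' q" if x: "x \<in> {a..b}" and "y \<le> y'" for x y y' q
  proof (cases "y = y'")
    case False
    have "0 \<le> (F (x, y', e x * q) - F (x, y, e x * q)) * (y' - y)"
      using assms(9) x by blast
    with False \<open>y \<le> y'\<close> have "F (x, y, e x * q) \<le> F (x, y', e x * q)"
      by (simp add: zero_le_mult_iff)
    then show ?thesis
      unfolding H_def by (intro mult_left_mono w(2))
  qed simp
  \<comment> \<open>Subtracting the solution \<open>A + c * E\<close> of \<open>L u = 0\<close> with the same boundary values makes the
    boundary conditions homogeneous.\<close>
  obtain E where Ea: "E a = 0" and E: "\<And>x. (E has_real_derivative e x) (at x)"
    using antiderivative_ex[OF e(1)] by blast
  have "E a < E b"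
    by (rule DERIV_pos_imp_increasing[OF \<open>a < b\<close>]) (use E e(2) in blast)
  define c where "c = (B - A) / E b"
  have cE: "c * E b = B - A" using \<open>E a < E b\<close> Ea by (simp add: c_def)
  \<comment> \<open>\<open>c\<close> is the constant value of \<open>exp \<Sigma>\<close> times the
    derivative of \<open>A + c * E\<close>. The subtraction thus only translates \<open>y\<close>
    and \<open>q\<close>, which affects neither monotonicity nor \<open>K\<close>.\<close>
  have shifted_cont: "continuous_on ({a..b} \<times> UNIV) (\<lambda>(x, y, q). H x (A + c * E x + y) (q + c))"
  proof -
    have E_cont: "continuous_on UNIV E" by (rule DERIV_imp_continuous_on_UNIV) (rule E)
    have *: "continuous_on ({a..b} \<times> UNIV) (\<lambda>z::real \<times> real \<times> real. h (fst z))" if "continuous_on UNIV h" for h :: "real \<Rightarrow> real"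
      by (rule continuous_on_compose2[OF that]) (auto intro!: continuous_intros)
    have "continuous_on ({a..b} \<times> UNIV) (\<lambda>z::real \<times> real \<times> real. (fst z, A + c * E (fst z) + fst (snd z), e (fst z) * (snd (snd z) + c)))"
      by (intro continuous_intros * E_cont e)
    from continuous_on_compose2[OF F this] show ?thesis
      unfolding H_def case_prod_beta by (intro continuous_on_mult * w) (simp add: image_subset_iff mem_Times_iff)
  qed
  obtain v Q where v: "\<And>x. x \<in> {a..b} \<Longrightarrow> (v has_real_derivative e x * Q x) (at x within {a..b})"
    and Q: "\<And>x. x \<in> {a..b} \<Longrightarrow> (Q has_real_derivative H x (A + c * E x + v x) (Q x + c)) (at x within {a..b})"
    and bc: "v a = 0" "v b = 0"
  proof (rule first_order_bvp_exists[OF \<open>a < b\<close> \<open>K \<ge> 0\<close> e shifted_cont])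
    show "\<bar>H x (A + c * E x + y) (q + c) - H x (A + c * E x + y) (q' + c)\<bar> \<le> K * \<bar>q - q'\<bar>"
      if "x \<in> {a..b}" for x y q q'
      using H_lip[OF that, of _ "q + c" "q' + c"] by simp
  qed (use H_mono in auto)
  define u where "u x = A + c * E x + v x" for x
  have u: "(u has_real_derivative e x * (Q x + c)) (at x within {a..b})" if "x \<in> {a..b}" for x
    unfolding u_def
    by (auto intro!: derivative_eq_intros v that has_field_derivative_at_within[OF E] simp: algebra_simps)
  have P: "((\<lambda>x. Q x + c) has_real_derivative H x (u x) (Q x + c)) (at x within {a..b})" if "x \<in> {a..b}" for x
    unfolding u_def using Q[OF that] by (auto intro!: derivative_eq_intros)
  have "bvp_solution_nonlinear \<sigma> \<beta> a b A B F (restrict u {a..b})"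
  proof (rule system_imp_bvp_solution_nonlinear[OF coeffs F, where P = "\<lambda>x. Q x + c"])
    fix x assume x: "x \<in> {a..b}"
    show "(restrict u {a..b} has_real_derivative exp (- \<Sigma> x) * (Q x + c)) (at x within {a..b})"
      by (rule has_field_derivative_transform_within[OF _ zero_less_one x]) (use u[OF x] in \<open>simp_all add: e_def\<close>)
    show "((\<lambda>x. Q x + c) has_real_derivative 2 * exp (\<Sigma> x) / (\<sigma> x)\<^sup>2 *
        F (x, restrict u {a..b} x, exp (- \<Sigma> x) * (Q x + c))) (at x within {a..b})"
      using P[OF x] x by (simp add: H_def w_def e_def)
  qed (use \<open>a < b\<close> bc cE Ea in \<open>simp_all add: u_def\<close>)
  moreover have "u1 = u2"
    if u1: "u1 \<in> extensional {a..b}" "bvp_solution_nonlinear \<sigma> \<beta> a b A B F u1"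
      and u2: "u2 \<in> extensional {a..b}" "bvp_solution_nonlinear \<sigma> \<beta> a b A B F u2" for u1 u2
  proof (rule extensionalityI[OF u1(1) u2(1)])
    obtain P1 where P1: "u1 a = A" "u1 b = B"
      "\<And>x. x \<in> {a..b} \<Longrightarrow> (u1 has_real_derivative e x * P1 x) (at x within {a..b})"
      "\<And>x. x \<in> {a..b} \<Longrightarrow> (P1 has_real_derivative H x (u1 x) (P1 x)) (at x within {a..b})"
      using bvp_solution_nonlinear_imp_system[OF coeffs u1(2)] unfolding e_def H_def w_def by blast
    obtain P2 where P2: "u2 a = A" "u2 b = B"
      "\<And>x. x \<in> {a..b} \<Longrightarrow> (u2 has_real_derivative e x * P2 x) (at x within {a..b})"
      "\<And>x. x \<in> {a..b} \<Longrightarrow> (P2 has_real_derivative H x (u2 x) (P2 x)) (at x within {a..b})"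
      using bvp_solution_nonlinear_imp_system[OF coeffs u2(2)] unfolding e_def H_def w_def by blast
    fix x assume "x \<in> {a..b}"
    show "u1 x = u2 x"
      by (rule first_order_bvp_unique[where e = e and H = H and K = K and a = a and b = b and Q = P1 and P = P2])
        (use \<open>a < b\<close> \<open>K \<ge> 0\<close> e H_mono H_lip P1 P2 \<open>x \<in> {a..b}\<close> continuous_on_subset[OF e(1)] in auto)
  qed
  ultimately show ?thesis
    by (intro ex1I[of _ "restrict u {a..b}"]) auto
qed

end
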